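(* Let $P(D)$ be a differential operator with coefficients in $\widetilde{\mathbb{C}}$, of principal type and degree $m$, and let one of the coefficients of its principal part $P_m(D)$ be invertible in $\widetilde{\mathbb{C}}$. Then: (i) $P(D)$ dominates every differential operator with coefficients in $\widetilde{\mathbb{C}}$ of order $\le m-1$; (ii) if $Q(D)$ is a differential operator with coefficients in $\widetilde{\mathbb{C}}$ of order $m$ and there exist a moderate net $(\lambda_\varepsilon)_\varepsilon$ and representatives $(Q_{m,\varepsilon})_\varepsilon$ and $(P_{m,\varepsilon})_\varepsilon$ of the principal symbols such that $|Q_{m,\varepsilon}(\xi)|\le\lambda_\varepsilon|P_{m,\varepsilon}(\xi)|$ for all $\xi\in\mathbb{R}^n$ and $\varepsilon\in(0,1]$, then $Q(D)\prec P(D)$.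
   Context: Nets are indexed by $\varepsilon\in(0,1]$. A net $(\lambda_\varepsilon)_\varepsilon$ of complex numbers is moderate if $|\lambda_\varepsilon|=O(\varepsilon^{-N})$ as $\varepsilon\to0$ for some $N\in\mathbb{N}$, negligible if $|\lambda_\varepsilon|=O(\varepsilon^q)$ for all $q\in\mathbb{N}$. $\widetilde{\mathbb{C}}$ is the ring of moderate nets modulo negligible nets. A differential operator of order $m$ with coefficients in $\widetilde{\mathbb{C}}$ is $P(D)=\sum_{|\alpha|\le m}c_\alpha D^\alpha$ on $\mathbb{R}^n$, $c_\alpha\in\widetilde{\mathbb{C}}$, $D=-i\partial$, with polynomial $P(\xi)=\sum_{|\alpha|\le m}c_\alpha\xi^\alpha$ and principal symbol $P_m(\xi)=\sum_{|\alpha|=m}c_\alpha\xi^\alpha$. A representative of $P$ (resp. $P_m$) is a net of polynomials $(P_\varepsilon)_\varepsilon$ (resp. $(P_{m,\varepsilon})_\varepsilon$) obtained by replacing each $c_\alpha$ by a representative $(c_{\alpha,\varepsilon})_\varepsilon$. For a polynomial $Q$ and $t>0$, $\widetilde Q(\xi,t)=(\sum_\alpha|\partial^\alpha Q(\xi)|^2t^{2|\alpha|})^{1/2}$ and $\widetilde Q(\xi)=\widetilde Q(\xi,1)$. $P(D)$ is of principal type if there exist a representative $(P_{m,\varepsilon})_\varepsilon$ of $P_m$, $a\in\mathbb{R}$ and $c>0$ such that $|\nabla_\xi P_{m,\varepsilon}(\xi)|\ge c\,\varepsilon^a|\xi|^{m-1}$ for all $\varepsilon\in(0,1]$ and $\xi\in\mathbb{R}^n$.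 $Q(D)\prec P(D)$ ($P(D)$ is stronger than $Q(D)$) means: there exist representatives $(P_\varepsilon)_\varepsilon$, $(Q_\varepsilon)_\varepsilon$ and a moderate net $(\lambda_\varepsilon)_\varepsilon$ with $\widetilde{Q_\varepsilon}(\xi)\le\lambda_\varepsilon\widetilde{P_\varepsilon}(\xi)$ for all $\xi\in\mathbb{R}^n$, $\varepsilon\in(0,1]$. $P(D)$ dominates $Q(D)$ (written $Q(D)\prec\prec P(D)$) means: there exist representatives $(P_\varepsilon)_\varepsilon$, $(Q_\varepsilon)_\varepsilon$, a moderate net $(\lambda_\varepsilon)_\varepsilon$ and a function $C(t)>0$ with $\lim_{t\to+\infty}C(t)=0$ and the property that for all $a\in\mathbb{R}$ there is $b\in\mathbb{R}$ such that for all $\varepsilon\in(0,1]$ and all $t\ge\varepsilon^b$ (with $t\ge1$) one has $C(t)\le\varepsilon^a$, such that $\widetilde{Q_\varepsilon}(\xi,t)\le\lambda_\varepsilon C(t)\widetilde{P_\varepsilon}(\xi,t)$ for all $\xi\in\mathbb{R}^n$, $\varepsilon\in(0,1]$ and $t\ge1$. *)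

theory Defs
  imports
    "HOL-Analysis.Analysis"
    "HOL-Library.Landau_Symbols"
    "HOL-Library.Groups_Big_Fun"
begin

section \<open>The ring of generalized complex numbers\<close>

text \<open>A net indexed by \<open>\<epsilon> \<in> (0,1]\<close> is a function on \<open>real\<close> of which only the values on
  \<open>{0<..1}\<close> are ever used; the filter \<open>at_right 0\<close> expresses \<open>\<epsilon> \<rightarrow> 0\<close> inside \<open>(0,1]\<close>.\<close>

definition moderate :: "(real \<Rightarrow> 'a::real_normed_vector) \<Rightarrow> bool" where
  "moderate u \<longleftrightarrow> (\<exists>N::nat. (\<lambda>\<epsilon>. norm (u \<epsilon>)) \<in> O[at_right 0](\<lambda>\<epsilon>. 1 / \<epsilon> ^ N))"

definition negligible_net :: "(real \<Rightarrow> 'a::real_normed_vector) \<Rightarrow> bool" where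
  "negligible_net u \<longleftrightarrow> (\<forall>q::nat. (\<lambda>\<epsilon>. norm (u \<epsilon>)) \<in> O[at_right 0](\<lambda>\<epsilon>. \<epsilon> ^ q))"

lemma negligible_imp_moderate: "negligible_net u \<Longrightarrow> moderate u"
  unfolding negligible_net_def moderate_def
  by (rule exI[of _ 0]) (drule spec[of _ 0], simp)

lemma moderate_0: "moderate (\<lambda>_. 0)"
  unfolding moderate_def by simp

lemma negligible_0: "negligible_net (\<lambda>_. 0)"
  unfolding negligible_net_def by simp

lemma moderate_1: "moderate (\<lambda>_. 1 :: 'a::real_normed_algebra_1)"
  unfolding moderate_def by (rule exI[of _ 0]) simp

lemma moderate_minus: "moderate u \<Longrightarrow> moderate (\<lambda>\<epsilon>. - u \<epsilon>)"
  unfolding moderate_def by simp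

lemma negligible_minus: "negligible_net u \<Longrightarrow> negligible_net (\<lambda>\<epsilon>. - u \<epsilon>)"
  unfolding negligible_net_def by simp

lemma bigo_norm_add:
  fixes u v :: "real \<Rightarrow> 'a::real_normed_vector" and g :: "real \<Rightarrow> real"
  assumes "(\<lambda>\<epsilon>. norm (u \<epsilon>)) \<in> O[F](g)" "(\<lambda>\<epsilon>. norm (v \<epsilon>)) \<in> O[F](g)"
  shows "(\<lambda>\<epsilon>. norm (u \<epsilon> + v \<epsilon>)) \<in> O[F](g)"
proof -
  have "(\<lambda>\<epsilon>. norm (u \<epsilon> + v \<epsilon>)) \<in> O[F](\<lambda>\<epsilon>. norm (u \<epsilon>) + norm (v \<epsilon>))"
    by (rule bigoI[of _ 1]) (simp add: norm_triangle_ineq)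
  also have "(\<lambda>\<epsilon>. norm (u \<epsilon>) + norm (v \<epsilon>)) \<in> O[F](g)"
    using assms by (rule sum_in_bigo)
  finally show ?thesis .
qed

lemma bigo_norm_mult:
  fixes u v :: "real \<Rightarrow> 'a::real_normed_algebra" and g h :: "real \<Rightarrow> real"
  assumes "(\<lambda>\<epsilon>. norm (u \<epsilon>)) \<in> O[F](g)" "(\<lambda>\<epsilon>. norm (v \<epsilon>)) \<in> O[F](h)"
  shows "(\<lambda>\<epsilon>. norm (u \<epsilon> * v \<epsilon>)) \<in> O[F](\<lambda>\<epsilon>. g \<epsilon> * h \<epsilon>)"
proof -
  have "(\<lambda>\<epsilon>. norm (u \<epsilon> * v \<epsilon>)) \<in> O[F](\<lambda>\<epsilon>. norm (u \<epsilon>) * norm (v \<epsilon>))"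
    by (rule bigoI[of _ 1]) (simp add: norm_mult_ineq)
  also have "(\<lambda>\<epsilon>. norm (u \<epsilon>) * norm (v \<epsilon>)) \<in> O[F](\<lambda>\<epsilon>. g \<epsilon> * h \<epsilon>)"
    using assms by (rule landau_o.big.mult)
  finally show ?thesis .
qed

lemma bigo_inverse_power_mono:
  assumes "N \<le> M"
  shows "(\<lambda>\<epsilon>::real. 1 / \<epsilon> ^ N) \<in> O[at_right 0](\<lambda>\<epsilon>. 1 / \<epsilon> ^ M)"
proof (rule bigoI[of _ 1])
  have "eventually (\<lambda>\<epsilon>::real. \<epsilon> \<in> {0<..<1}) (at_right 0)"
    by (rule eventually_at_right_real) simp
  then show "eventually (\<lambda>\<epsilon>::real. norm (1 / \<epsilon> ^ N) \<le> 1 * norm (1 / \<epsilon> ^ M)) (at_right 0)"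
    by eventually_elim (use assms in \<open>auto intro!: divide_left_mono power_decreasing\<close>)
qed

lemma moderate_add:
  assumes "moderate u" "moderate v"
  shows "moderate (\<lambda>\<epsilon>. u \<epsilon> + v \<epsilon>)"
proof -
  obtain N M where N: "(\<lambda>\<epsilon>. norm (u \<epsilon>)) \<in> O[at_right 0](\<lambda>\<epsilon>. 1 / \<epsilon> ^ N)"
    and M: "(\<lambda>\<epsilon>. norm (v \<epsilon>)) \<in> O[at_right 0](\<lambda>\<epsilon>. 1 / \<epsilon> ^ M)"
    using assms unfolding moderate_def by blast
  have "(\<lambda>\<epsilon>. norm (u \<epsilon> + v \<epsilon>)) \<in> O[at_right 0](\<lambda>\<epsilon>. 1 / \<epsilon> ^ max N M)"
    by (intro bigo_norm_add landau_o.big_trans[OF N] landau_o.big_trans[OF M]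
          bigo_inverse_power_mono) auto
  then show ?thesis unfolding moderate_def by blast
qed

lemma moderate_mult:
  fixes u v :: "real \<Rightarrow> 'a::real_normed_algebra"
  assumes "moderate u" "moderate v"
  shows "moderate (\<lambda>\<epsilon>. u \<epsilon> * v \<epsilon>)"
proof -
  obtain N M where "(\<lambda>\<epsilon>. norm (u \<epsilon>)) \<in> O[at_right 0](\<lambda>\<epsilon>. 1 / \<epsilon> ^ N)"
    and "(\<lambda>\<epsilon>. norm (v \<epsilon>)) \<in> O[at_right 0](\<lambda>\<epsilon>. 1 / \<epsilon> ^ M)"
    using assms unfolding moderate_def by blast
  from bigo_norm_mult[OF this]
  have "(\<lambda>\<epsilon>. norm (u \<epsilon> * v \<epsilon>)) \<in> O[at_right 0](\<lambda>\<epsilon>. 1 / \<epsilon> ^ (N + M))"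
    by (simp add: power_add)
  then show ?thesis unfolding moderate_def by blast
qed

lemma negligible_add:
  "negligible_net u \<Longrightarrow> negligible_net v \<Longrightarrow> negligible_net (\<lambda>\<epsilon>. u \<epsilon> + v \<epsilon>)"
  unfolding negligible_net_def by (auto intro: bigo_norm_add)

lemma moderate_diff: "moderate u \<Longrightarrow> moderate v \<Longrightarrow> moderate (\<lambda>\<epsilon>. u \<epsilon> - v \<epsilon>)"
  using moderate_add[OF _ moderate_minus, of u v] by simp

lemma negligible_diff:
  "negligible_net u \<Longrightarrow> negligible_net v \<Longrightarrow> negligible_net (\<lambda>\<epsilon>. u \<epsilon> - v \<epsilon>)"
  using negligible_add[OF _ negligible_minus, of u v] by simp

lemma negligible_mult_moderate:
  fixes u v :: "real \<Rightarrow> 'a::real_normed_algebra"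
  assumes "negligible_net u" "moderate v"
  shows "negligible_net (\<lambda>\<epsilon>. u \<epsilon> * v \<epsilon>)"
  unfolding negligible_net_def
proof
  fix q :: nat
  obtain N where N: "(\<lambda>\<epsilon>. norm (v \<epsilon>)) \<in> O[at_right 0](\<lambda>\<epsilon>. 1 / \<epsilon> ^ N)"
    using assms(2) unfolding moderate_def by blast
  have "(\<lambda>\<epsilon>. norm (u \<epsilon>)) \<in> O[at_right 0](\<lambda>\<epsilon>. \<epsilon> ^ (q + N))"
    using assms(1) unfolding negligible_net_def by blast
  from bigo_norm_mult[OF this N]
  have "(\<lambda>\<epsilon>. norm (u \<epsilon> * v \<epsilon>)) \<in> O[at_right 0](\<lambda>\<epsilon>. \<epsilon> ^ (q + N) * (1 / \<epsilon> ^ N))" .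
  also have "(\<lambda>\<epsilon>. \<epsilon> ^ (q + N) * (1 / \<epsilon> ^ N)) \<in> O[at_right 0](\<lambda>\<epsilon>::real. \<epsilon> ^ q)"
  proof (rule bigoI[of _ 1])
    have "eventually (\<lambda>\<epsilon>::real. \<epsilon> \<in> {0<..<1}) (at_right 0)"
      by (rule eventually_at_right_real) simp
    then show "eventually (\<lambda>\<epsilon>::real. norm (\<epsilon> ^ (q + N) * (1 / \<epsilon> ^ N)) \<le> 1 * norm (\<epsilon> ^ q)) (at_right 0)"
      by eventually_elim (auto simp: power_add)
  qed
  finally show "(\<lambda>\<epsilon>. norm (u \<epsilon> * v \<epsilon>)) \<in> O[at_right 0](\<lambda>\<epsilon>. \<epsilon> ^ q)" .
qed

lemma not_negligible_1: "\<not> negligible_net (\<lambda>_. 1 :: 'a::real_normed_algebra_1)"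
proof
  assume "negligible_net (\<lambda>_. 1 :: 'a)"
  then have "(\<lambda>\<epsilon>. norm (1::'a)) \<in> O[at_right 0](\<lambda>\<epsilon>. \<epsilon> ^ 1)"
    unfolding negligible_net_def by blast
  then obtain c where "c > 0" and c: "eventually (\<lambda>\<epsilon>::real. 1 \<le> c * \<bar>\<epsilon>\<bar>) (at_right 0)"
    by (auto elim!: landau_o.bigE)
  have "eventually (\<lambda>\<epsilon>::real. \<epsilon> \<in> {0<..<1 / c}) (at_right 0)"
    by (rule eventually_at_right_real) (use \<open>c > 0\<close> in simp)
  with c have "eventually (\<lambda>\<epsilon>::real. False) (at_right 0)"
    by eventually_elim (use \<open>c > 0\<close> in \<open>auto simp: field_simps\<close>)
  then show False by simp
qed

definition gc_rel :: "(real \<Rightarrow> complex) \<Rightarrow> (real \<Rightarrow> complex) \<Rightarrow> bool" where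
  "gc_rel u v \<longleftrightarrow> moderate u \<and> moderate v \<and> negligible_net (\<lambda>\<epsilon>. u \<epsilon> - v \<epsilon>)"

lemma part_equivp_gc_rel: "part_equivp gc_rel"
proof (rule part_equivpI)
  show "\<exists>u. gc_rel u u"
    by (rule exI[of _ "\<lambda>_. 0"]) (simp add: gc_rel_def moderate_0 negligible_0)
  show "symp gc_rel"
  proof (rule sympI)
    fix u v assume "gc_rel u v"
    then show "gc_rel v u"
      using negligible_minus[of "\<lambda>\<epsilon>. u \<epsilon> - v \<epsilon>"] by (simp add: gc_rel_def)
  qed
  show "transp gc_rel"
  proof (rule transpI)
    fix u v w assume "gc_rel u v" "gc_rel v w"
    then show "gc_rel u w"
      using negligible_add[of "\<lambda>\<epsilon>. u \<epsilon> - v \<epsilon>" "\<lambda>\<epsilon>. v \<epsilon> - w \<epsilon>"] by (simp add: gc_rel_def)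
  qed
qed

lemma gc_rel_eqI: "moderate u \<Longrightarrow> u = v \<Longrightarrow> gc_rel u v"
  by (simp add: gc_rel_def negligible_0)

quotient_type gcomplex = "real \<Rightarrow> complex" / partial: gc_rel
  by (rule part_equivp_gc_rel)

instantiation gcomplex :: comm_ring_1
begin

lift_definition zero_gcomplex :: gcomplex is "\<lambda>_. 0"
  by (simp add: gc_rel_def moderate_0 negligible_0)

lift_definition one_gcomplex :: gcomplex is "\<lambda>_. 1"
  by (simp add: gc_rel_def moderate_1 negligible_0)

lift_definition plus_gcomplex :: "gcomplex \<Rightarrow> gcomplex \<Rightarrow> gcomplex" is "\<lambda>u v \<epsilon>. u \<epsilon> + v \<epsilon>"
proof -
  fix u u' v v' :: "real \<Rightarrow> complex"
  assume "gc_rel u u'" "gc_rel v v'"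
  then show "gc_rel (\<lambda>\<epsilon>. u \<epsilon> + v \<epsilon>) (\<lambda>\<epsilon>. u' \<epsilon> + v' \<epsilon>)"
    using negligible_add[of "\<lambda>\<epsilon>. u \<epsilon> - u' \<epsilon>" "\<lambda>\<epsilon>. v \<epsilon> - v' \<epsilon>"]
    by (simp add: gc_rel_def add_diff_add moderate_add)
qed

lift_definition uminus_gcomplex :: "gcomplex \<Rightarrow> gcomplex" is "\<lambda>u \<epsilon>. - u \<epsilon>"
proof -
  fix u u' :: "real \<Rightarrow> complex"
  assume "gc_rel u u'"
  then show "gc_rel (\<lambda>\<epsilon>. - u \<epsilon>) (\<lambda>\<epsilon>. - u' \<epsilon>)"
    using negligible_minus[of "\<lambda>\<epsilon>. u \<epsilon> - u' \<epsilon>"] by (simp add: gc_rel_def moderate_minus)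
qed

lift_definition minus_gcomplex :: "gcomplex \<Rightarrow> gcomplex \<Rightarrow> gcomplex" is "\<lambda>u v \<epsilon>. u \<epsilon> - v \<epsilon>"
proof -
  fix u u' v v' :: "real \<Rightarrow> complex"
  assume a: "gc_rel u u'" "gc_rel v v'"
  have "negligible_net (\<lambda>\<epsilon>. (u \<epsilon> - u' \<epsilon>) - (v \<epsilon> - v' \<epsilon>))"
    using a by (intro negligible_diff[where u = "\<lambda>\<epsilon>. u \<epsilon> - u' \<epsilon>" and v = "\<lambda>\<epsilon>. v \<epsilon> - v' \<epsilon>"]) (simp_all add: gc_rel_def)
  then show "gc_rel (\<lambda>\<epsilon>. u \<epsilon> - v \<epsilon>) (\<lambda>\<epsilon>. u' \<epsilon> - v' \<epsilon>)"
    using a by (simp add: gc_rel_def moderate_diff algebra_simps)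
qed

lift_definition times_gcomplex :: "gcomplex \<Rightarrow> gcomplex \<Rightarrow> gcomplex" is "\<lambda>u v \<epsilon>. u \<epsilon> * v \<epsilon>"
proof -
  fix u u' v v' :: "real \<Rightarrow> complex"
  assume a: "gc_rel u u'" "gc_rel v v'"
  have "moderate (\<lambda>\<epsilon>. u \<epsilon> * v \<epsilon>)" "moderate (\<lambda>\<epsilon>. u' \<epsilon> * v' \<epsilon>)"
    using a unfolding gc_rel_def by (blast intro: moderate_mult)+
  moreover have "negligible_net (\<lambda>\<epsilon>. (u \<epsilon> - u' \<epsilon>) * v \<epsilon> + (v \<epsilon> - v' \<epsilon>) * u' \<epsilon>)"
    using a by (intro negligible_add negligible_mult_moderate) (simp_all add: gc_rel_def)
  ultimately show "gc_rel (\<lambda>\<epsilon>. u \<epsilon> * v \<epsilon>) (\<lambda>\<epsilon>. u' \<epsilon> * v' \<epsilon>)"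
    by (simp add: gc_rel_def algebra_simps)
qed

instance
proof
  show "(0::gcomplex) \<noteq> 1"
  proof transfer
    show "\<not> gc_rel (\<lambda>_. 0) (\<lambda>_. 1)"
      using not_negligible_1[where 'a = complex] negligible_minus[of "\<lambda>_. -1 :: complex"]
      by (auto simp: gc_rel_def)
  qed
qed (transfer, rule gc_rel_eqI,
     (intro moderate_add moderate_mult moderate_minus moderate_diff moderate_0 moderate_1;
       simp add: gc_rel_def),
     simp add: fun_eq_iff algebra_simps)+

end

definition represents :: "(real \<Rightarrow> complex) \<Rightarrow> gcomplex \<Rightarrow> bool" where
  "represents u c \<longleftrightarrow> moderate u \<and> abs_gcomplex u = c"


section \<open>Polynomials in several real variables\<close>

text \<open>A polynomial is its finitely supported family of complex coefficients.\<close>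

type_synonym 'n mindex = "'n \<Rightarrow> nat"

definition mdeg :: "'n::finite mindex \<Rightarrow> nat" where
  "mdeg \<alpha> = (\<Sum>i\<in>UNIV. \<alpha> i)"

definition mpow :: "real ^ 'n::finite \<Rightarrow> 'n mindex \<Rightarrow> complex" where
  "mpow \<xi> \<alpha> = (\<Prod>i\<in>UNIV. complex_of_real (\<xi> $ i) ^ \<alpha> i)"

definition peval :: "('n::finite mindex \<Rightarrow> complex) \<Rightarrow> real ^ 'n \<Rightarrow> complex" where
  "peval p \<xi> = Sum_any (\<lambda>\<alpha>. p \<alpha> * mpow \<xi> \<alpha>)"

text \<open>Coefficients of \<open>\<partial>\<^sup>\<alpha> p\<close>, from
  \<open>\<partial>\<^sup>\<alpha> \<xi>\<^bsup>\<alpha>+\<beta>\<^esup> = ((\<alpha>+\<beta>)! / \<beta>!) \<xi>\<^sup>\<beta>\<close>. The lemmas \<open>pdiff_zero\<close>, \<open>pdiff_add\<close> and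
  \<open>has_vector_derivative_peval\<close> below identify this with the iterated partial derivative.\<close>

definition pdiff :: "'n::finite mindex \<Rightarrow> ('n mindex \<Rightarrow> complex) \<Rightarrow> 'n mindex \<Rightarrow> complex" where
  "pdiff \<alpha> p = (\<lambda>\<beta>. (\<Prod>i\<in>UNIV. fact (\<alpha> i + \<beta> i) / fact (\<beta> i)) * p (\<lambda>i. \<alpha> i + \<beta> i))"

definition munit :: "'n \<Rightarrow> 'n mindex" where
  "munit i = (\<lambda>j. if j = i then 1 else 0)"

definition pgrad :: "('n::finite mindex \<Rightarrow> complex) \<Rightarrow> real ^ 'n \<Rightarrow> complex ^ 'n" where
  "pgrad p \<xi> = (\<chi> i. peval (pdiff (munit i) p) \<xi>)"

lemma pdiff_zero: "pdiff (\<lambda>_. 0) p = p"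
  by (simp add: pdiff_def)

lemma pdiff_add: "pdiff (\<lambda>i. \<alpha> i + \<beta> i) p = pdiff \<alpha> (pdiff \<beta> p)"
proof
  fix \<gamma>
  have "(\<Prod>i\<in>UNIV. fact (\<alpha> i + \<gamma> i) / fact (\<gamma> i)) *
        (\<Prod>i\<in>UNIV. fact (\<beta> i + (\<alpha> i + \<gamma> i)) / fact (\<alpha> i + \<gamma> i)) =
        (\<Prod>i\<in>UNIV. fact (\<alpha> i + \<beta> i + \<gamma> i) / fact (\<gamma> i) :: complex)"
    unfolding prod.distrib[symmetric] by (rule prod.cong) (simp_all add: add_ac)
  then show "pdiff (\<lambda>i. \<alpha> i + \<beta> i) p \<gamma> = pdiff \<alpha> (pdiff \<beta> p) \<gamma>"
    by (simp add: pdiff_def add_ac flip: mult.assoc)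
qed

lemma has_vector_derivative_mpow:
  "((\<lambda>s. mpow (\<xi> + s *\<^sub>R axis i 1) \<alpha>) has_vector_derivative
     of_nat (\<alpha> i) * mpow \<xi> (\<lambda>j. if j = i then \<alpha> j - 1 else \<alpha> j)) (at 0)"
proof -
  define R where "R = (\<Prod>j\<in>UNIV - {i}. complex_of_real (\<xi> $ j) ^ \<alpha> j)"
  have 1: "mpow (\<xi> + s *\<^sub>R axis i 1) \<alpha> = complex_of_real ((\<xi> $ i + s) ^ \<alpha> i) * R" for s
    unfolding mpow_def R_def
    by (subst prod.remove[of _ i]) (auto simp: axis_def intro!: arg_cong2[of _ _ _ _ "(*)"] prod.cong)
  have 2: "mpow \<xi> (\<lambda>j. if j = i then \<alpha> j - 1 else \<alpha> j) = complex_of_real ((\<xi> $ i) ^ (\<alpha> i - 1)) * R"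
    unfolding mpow_def R_def
    by (subst prod.remove[of _ i]) (auto intro!: arg_cong2[of _ _ _ _ "(*)"] prod.cong)
  have "((\<lambda>s. (\<xi> $ i + s) ^ \<alpha> i) has_real_derivative of_nat (\<alpha> i) * (\<xi> $ i) ^ (\<alpha> i - 1)) (at 0)"
    by (auto intro!: derivative_eq_intros)
  from has_vector_derivative_of_real[OF this, where 'a = complex]
  have "((\<lambda>s. complex_of_real ((\<xi> $ i + s) ^ \<alpha> i) * R) has_vector_derivative
      complex_of_real (of_nat (\<alpha> i) * (\<xi> $ i) ^ (\<alpha> i - 1)) * R) (at 0)"
    by (rule has_vector_derivative_mult_left)
  then show ?thesis unfolding 1 2 by (simp add: mult.assoc)
qed

lemma pdiff_munit:
  "pdiff (munit i) p \<beta> = of_nat (\<beta> i + 1) * p (\<lambda>j. munit i j + \<beta> j)"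
proof -
  have "(\<Prod>j\<in>UNIV. fact (munit i j + \<beta> j) / fact (\<beta> j) :: complex) = of_nat (\<beta> i + 1)"
    by (subst prod.remove[of _ i]) (auto simp: munit_def)
  then show ?thesis by (simp add: pdiff_def)
qed

lemma has_vector_derivative_peval:
  assumes fin: "finite {\<alpha>. p \<alpha> \<noteq> 0}"
  shows "((\<lambda>s. peval p (\<xi> + s *\<^sub>R axis i 1)) has_vector_derivative
            peval (pdiff (munit i) p) \<xi>) (at 0)"
proof -
  let ?S = "{\<alpha>. p \<alpha> \<noteq> 0}"
  let ?down = "\<lambda>\<alpha>::'a mindex. (\<lambda>j. if j = i then \<alpha> j - 1 else \<alpha> j)"
  let ?up = "\<lambda>\<beta>::'a mindex. (\<lambda>j. munit i j + \<beta> j)"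
  have eval: "peval p \<eta> = (\<Sum>\<alpha>\<in>?S. p \<alpha> * mpow \<eta> \<alpha>)" for \<eta>
    unfolding peval_def by (rule Sum_any.expand_superset) (use fin in auto)
  have "((\<lambda>s. \<Sum>\<alpha>\<in>?S. p \<alpha> * mpow (\<xi> + s *\<^sub>R axis i 1) \<alpha>) has_vector_derivative
      (\<Sum>\<alpha>\<in>?S. p \<alpha> * (of_nat (\<alpha> i) * mpow \<xi> (?down \<alpha>)))) (at 0)"
    by (intro has_vector_derivative_sum has_vector_derivative_mult_right has_vector_derivative_mpow)
  moreover have "(\<Sum>\<alpha>\<in>?S. p \<alpha> * (of_nat (\<alpha> i) * mpow \<xi> (?down \<alpha>))) = peval (pdiff (munit i) p) \<xi>"
  proof -
    let ?T = "{\<beta>. p (?up \<beta>) \<noteq> 0}"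
    have inj: "inj_on ?up ?T" by (auto simp: inj_on_def fun_eq_iff)
    have "?up ` ?T \<subseteq> ?S" by auto
    then have finT: "finite ?T" using inj_on_finite[OF inj _ fin] by blast
    have "peval (pdiff (munit i) p) \<xi> = (\<Sum>\<beta>\<in>?T. pdiff (munit i) p \<beta> * mpow \<xi> \<beta>)"
      unfolding peval_def by (rule Sum_any.expand_superset) (use finT in \<open>auto simp: pdiff_munit\<close>)
    also have "\<dots> = (\<Sum>\<alpha>\<in>{\<alpha>\<in>?S. \<alpha> i \<noteq> 0}. p \<alpha> * (of_nat (\<alpha> i) * mpow \<xi> (?down \<alpha>)))"
    proof (rule sum.reindex_bij_witness[of _ ?down ?up])
      fix \<beta> assume "\<beta> \<in> ?T"
      have "?down (?up \<beta>) = \<beta>" "munit i i = 1" by (auto simp: munit_def)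
      then show "?down (?up \<beta>) = \<beta>"
        and "p (?up \<beta>) * (of_nat (?up \<beta> i) * mpow \<xi> (?down (?up \<beta>))) = pdiff (munit i) p \<beta> * mpow \<xi> \<beta>"
        by (simp_all add: pdiff_munit)
      show "?up \<beta> \<in> {\<alpha>\<in>?S. \<alpha> i \<noteq> 0}" using \<open>\<beta> \<in> ?T\<close> by (auto simp: munit_def)
    next
      fix \<alpha> assume "\<alpha> \<in> {\<alpha>\<in>?S. \<alpha> i \<noteq> 0}"
      moreover from this have "?up (?down \<alpha>) = \<alpha>" by (auto simp: munit_def)
      ultimately show "?up (?down \<alpha>) = \<alpha>" and "?down \<alpha> \<in> ?T" by simp_all
    qed
    also have "\<dots> = (\<Sum>\<alpha>\<in>?S. p \<alpha> * (of_nat (\<alpha> i) * mpow \<xi> (?down \<alpha>)))"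
      by (rule sum.mono_neutral_left) (use fin in auto)
    finally show ?thesis by simp
  qed
  ultimately show ?thesis unfolding eval by simp
qed

definition ptilde :: "('n::finite mindex \<Rightarrow> complex) \<Rightarrow> real ^ 'n \<Rightarrow> real \<Rightarrow> real" where
  "ptilde p \<xi> t = sqrt (Sum_any (\<lambda>\<alpha>. (cmod (peval (pdiff \<alpha> p) \<xi>))\<^sup>2 * t ^ (2 * mdeg \<alpha>)))"


section \<open>Differential operators with generalized constant coefficients\<close>

text \<open>An operator \<open>P(D) = \<Sum>\<^bsub>|\<alpha>| \<le> m\<^esub> c\<^sub>\<alpha> D\<^sup>\<alpha>\<close> of order \<open>m\<close> is its coefficient family. As usual the
  order is the bound of the sum: top order coefficients may vanish.\<close>

definition diff_op :: "nat \<Rightarrow> ('n::finite mindex \<Rightarrow> gcomplex) \<Rightarrow> bool" where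
  "diff_op m P \<longleftrightarrow> (\<forall>\<alpha>. m < mdeg \<alpha> \<longrightarrow> P \<alpha> = 0)"

text \<open>\<open>p\<close> arises from \<open>\<Sum>\<^bsub>\<alpha> \<in> S\<^esub> c\<^sub>\<alpha> \<xi>\<^sup>\<alpha>\<close> by replacing each \<open>c\<^sub>\<alpha>\<close> by a representative; the
  monomials outside \<open>S\<close> do not occur in \<open>p \<epsilon>\<close>, not even with a negligible coefficient.\<close>

definition poly_rep ::
    "'n::finite mindex set \<Rightarrow> ('n mindex \<Rightarrow> gcomplex) \<Rightarrow> (real \<Rightarrow> 'n mindex \<Rightarrow> complex) \<Rightarrow> bool" where
  "poly_rep S c p \<longleftrightarrow>
     (\<forall>\<alpha>\<in>S. represents (\<lambda>\<epsilon>. p \<epsilon> \<alpha>) (c \<alpha>)) \<and> (\<forall>\<alpha>. \<alpha> \<notin> S \<longrightarrow> (\<forall>\<epsilon>\<in>{0<..1}. p \<epsilon> \<alpha> = 0))"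

definition symbol_rep ::
    "nat \<Rightarrow> ('n::finite mindex \<Rightarrow> gcomplex) \<Rightarrow> (real \<Rightarrow> 'n mindex \<Rightarrow> complex) \<Rightarrow> bool" where
  "symbol_rep m P p \<longleftrightarrow> poly_rep {\<alpha>. mdeg \<alpha> \<le> m} P p"

definition principal_rep ::
    "nat \<Rightarrow> ('n::finite mindex \<Rightarrow> gcomplex) \<Rightarrow> (real \<Rightarrow> 'n mindex \<Rightarrow> complex) \<Rightarrow> bool" where
  "principal_rep m P p \<longleftrightarrow> poly_rep {\<alpha>. mdeg \<alpha> = m} P p"

definition principal_type :: "nat \<Rightarrow> ('n::finite mindex \<Rightarrow> gcomplex) \<Rightarrow> bool" where
  "principal_type m P \<longleftrightarrow>
     (\<exists>p a c. principal_rep m P p \<and> c > 0 \<and>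
        (\<forall>\<epsilon>\<in>{0<..1}. \<forall>\<xi>. norm (pgrad (p \<epsilon>) \<xi>) \<ge> c * \<epsilon> powr a * norm \<xi> powi (int m - 1)))"

text \<open>In the next two definitions \<open>P\<close> has order \<open>m\<close> and \<open>Q\<close> has order \<open>k\<close>:
  \<open>Q(D) \<prec> P(D)\<close> and \<open>Q(D) \<prec>\<prec> P(D)\<close>.\<close>

definition stronger ::
    "nat \<Rightarrow> ('n::finite mindex \<Rightarrow> gcomplex) \<Rightarrow> nat \<Rightarrow> ('n mindex \<Rightarrow> gcomplex) \<Rightarrow> bool" where
  "stronger m P k Q \<longleftrightarrow>
     (\<exists>p q (L::real \<Rightarrow> real). symbol_rep m P p \<and> symbol_rep k Q q \<and> moderate L \<and>
        (\<forall>\<epsilon>\<in>{0<..1}. \<forall>\<xi>. ptilde (q \<epsilon>) \<xi> 1 \<le> L \<epsilon> * ptilde (p \<epsilon>) \<xi> 1))"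

definition dominates ::
    "nat \<Rightarrow> ('n::finite mindex \<Rightarrow> gcomplex) \<Rightarrow> nat \<Rightarrow> ('n mindex \<Rightarrow> gcomplex) \<Rightarrow> bool" where
  "dominates m P k Q \<longleftrightarrow>
     (\<exists>p q (L::real \<Rightarrow> real) (C::real \<Rightarrow> real).
        symbol_rep m P p \<and> symbol_rep k Q q \<and> moderate L \<and>
        (\<forall>t\<ge>1. C t > 0) \<and> (C \<longlongrightarrow> 0) at_top \<and>
        (\<forall>a. \<exists>b. \<forall>\<epsilon>\<in>{0<..1}. \<forall>t\<ge>1. t \<ge> \<epsilon> powr b \<longrightarrow> C t \<le> \<epsilon> powr a) \<and>
        (\<forall>\<epsilon>\<in>{0<..1}. \<forall>\<xi>. \<forall>t\<ge>1. ptilde (q \<epsilon>) \<xi> t \<le> L \<epsilon> * C t * ptilde (p \<epsilon>) \<xi> t))"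

end

theory Submission
  imports Defs
begin

text \<open>Everything follows from the estimate
  \<open>t (|\<xi>| + t)\<^bsup>m-1\<^esup> \<le> K\<^sub>\<epsilon> \<cdot> ptilde P\<^sub>\<epsilon> \<xi> t\<close> for \<open>t \<ge> 1\<close>, with \<open>K\<close> moderate. For \<open>|\<xi>|\<close> beyond a
  moderate radius, \<open>\<nabla>P\<^sub>\<epsilon>\<close> is a small perturbation of \<open>\<nabla>P\<^sub>m\<^sub>,\<^sub>\<epsilon>\<close>, so that
  \<open>t |\<nabla>P\<^sub>\<epsilon>(\<xi>)|\<close> controls \<open>t |\<xi>|\<^bsup>m-1\<^esup>\<close>; the invertible coefficient \<open>c\<^sub>\<alpha>\<close>
  of order \<open>m\<close> gives \<open>t\<^sup>m\<close> through \<open>\<partial>\<^sup>\<alpha>P\<^sub>\<epsilon> = \<alpha>! c\<^sub>\<alpha>\<close>, which also suffices inside the radius.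

  An operator of order less than \<open>m\<close> satisfies \<open>ptilde Q\<^sub>\<epsilon> \<xi> t \<le> M\<^sub>\<epsilon> (|\<xi>| + t)\<^bsup>m-1\<^esup>\<close> and is
  therefore dominated with \<open>C(t) = 1/t\<close>. For an operator of order \<open>m\<close> the only term of
  \<open>ptilde Q\<^sub>\<epsilon> \<xi> 1\<close> that is not of this lower size is \<open>|Q\<^sub>m\<^sub>,\<^sub>\<epsilon>(\<xi>)|\<close>, for which the hypothesis is made.\<close>

section \<open>Polynomials of bounded degree\<close>

lemma finite_mdeg_le: "finite {\<alpha>::'n::finite mindex. mdeg \<alpha> \<le> m}"
proof (rule finite_subset)
  show "{\<alpha>::'n mindex. mdeg \<alpha> \<le> m} \<subseteq> PiE UNIV (\<lambda>_. {..m})"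
  proof
    fix \<alpha> :: "'n mindex"
    assume "\<alpha> \<in> {\<alpha>. mdeg \<alpha> \<le> m}"
    moreover have "\<alpha> i \<le> mdeg \<alpha>" for i
      unfolding mdeg_def by (rule member_le_sum) simp_all
    ultimately show "\<alpha> \<in> PiE UNIV (\<lambda>_. {..m})"
      by (simp add: PiE_UNIV_domain Pi_def) (meson order_trans)
  qed
qed (rule finite_PiE; simp)

lemma mdeg_add: "mdeg (\<lambda>i. \<alpha> i + \<beta> i) = mdeg \<alpha> + mdeg \<beta>"
  by (simp add: mdeg_def sum.distrib)

lemma mdeg_munit: "mdeg (munit i) = 1"
  by (simp add: mdeg_def munit_def)

lemma mdeg_eq_0_iff: "mdeg \<alpha> = 0 \<longleftrightarrow> \<alpha> = (\<lambda>_. 0)"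
  by (auto simp: mdeg_def)

lemma norm_mpow_le: "cmod (mpow \<xi> \<alpha>) \<le> norm \<xi> ^ mdeg \<alpha>"
  unfolding mpow_def mdeg_def prod_norm[symmetric] power_sum norm_power
  by (intro prod_mono conjI power_mono) (auto simp: component_le_norm_cart)

text \<open>A bound on the support instead of an exact degree, since top order coefficients may
  vanish. It gives all sums over multi-indices the same finite index set and is stable under
  subtraction and \<open>pdiff\<close>.\<close>

definition supp_le :: "nat \<Rightarrow> ('n::finite mindex \<Rightarrow> complex) \<Rightarrow> bool" where
  "supp_le m p \<longleftrightarrow> (\<forall>\<alpha>. m < mdeg \<alpha> \<longrightarrow> p \<alpha> = 0)"

lemma peval_eq_sum:
  assumes "supp_le m p"
  shows "peval p \<xi> = (\<Sum>\<alpha> | mdeg \<alpha> \<le> m. p \<alpha> * mpow \<xi> \<alpha>)"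
  unfolding peval_def
  by (rule Sum_any.expand_superset[OF finite_mdeg_le])
     (use assms in \<open>auto simp: supp_le_def not_less[symmetric]\<close>)

lemma supp_le_diff: "supp_le m p \<Longrightarrow> supp_le m q \<Longrightarrow> supp_le m (\<lambda>\<alpha>. p \<alpha> - q \<alpha>)"
  by (simp add: supp_le_def)

lemma supp_le_pdiff: "supp_le m p \<Longrightarrow> supp_le m (pdiff \<alpha> p)"
  by (simp add: supp_le_def pdiff_def mdeg_add)

lemma peval_diff:
  assumes "supp_le m p" "supp_le m q"
  shows "peval (\<lambda>\<alpha>. p \<alpha> - q \<alpha>) \<xi> = peval p \<xi> - peval q \<xi>"
  using assms by (simp add: peval_eq_sum[of m] supp_le_diff sum_subtractf left_diff_distrib)

lemma pdiff_diff: "pdiff \<alpha> (\<lambda>\<beta>. p \<beta> - q \<beta>) = (\<lambda>\<beta>. pdiff \<alpha> p \<beta> - pdiff \<alpha> q \<beta>)"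
  by (simp add: pdiff_def right_diff_distrib)

lemma pdiff_eq_0:
  assumes "supp_le m p" "m < mdeg \<alpha>"
  shows "pdiff \<alpha> p = (\<lambda>_. 0)"
  using assms by (auto simp: supp_le_def pdiff_def mdeg_add)

lemma peval_0 [simp]: "peval (\<lambda>_. 0) \<xi> = 0"
  by (simp add: peval_def)

section \<open>Basic estimates for \<open>ptilde\<close>\<close>

lemma ptilde_eq_L2_set:
  assumes "supp_le m p"
  shows "ptilde p \<xi> t =
    L2_set (\<lambda>\<alpha>. cmod (peval (pdiff \<alpha> p) \<xi>) * t ^ mdeg \<alpha>) {\<alpha>. mdeg \<alpha> \<le> m}"
proof -
  \<comment> \<open>Derivatives of order above \<open>m\<close> vanish, so the formally infinite sum
    is finite and the library facts on Euclidean norms become available.\<close>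
  have "Sum_any (\<lambda>\<alpha>. (cmod (peval (pdiff \<alpha> p) \<xi>))\<^sup>2 * t ^ (2 * mdeg \<alpha>)) =
      (\<Sum>\<alpha> | mdeg \<alpha> \<le> m. (cmod (peval (pdiff \<alpha> p) \<xi>))\<^sup>2 * t ^ (2 * mdeg \<alpha>))"
    by (rule Sum_any.expand_superset[OF finite_mdeg_le])
       (use pdiff_eq_0[OF assms] in \<open>fastforce simp: not_less[symmetric]\<close>)
  then show ?thesis
    by (simp add: ptilde_def L2_set_def power_mult_distrib power_mult mult.commute[of 2])
qed

lemma ptilde_le_sum:
  assumes "supp_le m p" "0 \<le> t"
  shows "ptilde p \<xi> t \<le> (\<Sum>\<alpha> | mdeg \<alpha> \<le> m. cmod (peval (pdiff \<alpha> p) \<xi>) * t ^ mdeg \<alpha>)"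
  unfolding ptilde_eq_L2_set[OF assms(1)] by (rule L2_set_le_sum) (use assms in auto)

lemma ptilde_nonneg: "supp_le m p \<Longrightarrow> 0 \<le> ptilde p \<xi> t"
  by (simp add: ptilde_eq_L2_set L2_set_nonneg)

lemma peval_pdiff_le_ptilde:
  assumes "supp_le m p"
  shows "cmod (peval (pdiff \<alpha> p) \<xi>) * t ^ mdeg \<alpha> \<le> ptilde p \<xi> t"
proof (cases "mdeg \<alpha> \<le> m")
  case True
  then show ?thesis
    unfolding ptilde_eq_L2_set[OF assms]
    by (intro member_le_L2_set[of _ _ "\<lambda>\<alpha>. cmod (peval (pdiff \<alpha> p) \<xi>) * t ^ mdeg \<alpha>"] finite_mdeg_le) simp
next
  case False
  then show ?thesis
    using pdiff_eq_0[OF assms, of \<alpha>] ptilde_nonneg[OF assms] by simp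
qed

lemma ptilde_0 [simp]: "ptilde (\<lambda>_. 0) \<xi> t = 0"
  by (simp add: ptilde_def pdiff_def)

text \<open>A crude constant that absorbs every factor produced by applying
  \<open>pdiff \<alpha>\<close>. It depends on neither the coefficients nor the point, so it never
  affects moderateness.\<close>

definition pdiff_weight :: "nat \<Rightarrow> 'n::finite mindex \<Rightarrow> real" where
  "pdiff_weight m \<alpha> = (\<Sum>\<beta> | mdeg \<beta> \<le> m. \<Prod>i\<in>UNIV. fact (\<alpha> i + \<beta> i) / fact (\<beta> i))"

lemma pdiff_weight_nonneg: "0 \<le> pdiff_weight m \<alpha>"
  unfolding pdiff_weight_def by (intro sum_nonneg prod_nonneg) auto

text \<open>Termwise estimate. Leaving the common bound \<open>Z\<close> free lets it serve both a
  plain power of \<open>norm \<xi> + 1\<close> and the gradient comparison, where the size of a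
  coefficient depends on its degree.\<close>

lemma norm_peval_pdiff_le:
  assumes "supp_le m p"
    and Z: "\<And>\<beta>. mdeg \<alpha> + mdeg \<beta> \<le> m \<Longrightarrow> cmod (p (\<lambda>i. \<alpha> i + \<beta> i)) * norm \<xi> ^ mdeg \<beta> \<le> Z"
    and "0 \<le> Z"
  shows "cmod (peval (pdiff \<alpha> p) \<xi>) \<le> pdiff_weight m \<alpha> * Z"
proof -
  have Z': "cmod (p (\<lambda>i. \<alpha> i + \<beta> i)) * norm \<xi> ^ mdeg \<beta> \<le> Z" for \<beta>
    using Z[of \<beta>] assms(1,3) by (cases "mdeg \<alpha> + mdeg \<beta> \<le> m") (auto simp: supp_le_def mdeg_add)
  have "cmod (peval (pdiff \<alpha> p) \<xi>) \<le> (\<Sum>\<beta> | mdeg \<beta> \<le> m. cmod (pdiff \<alpha> p \<beta> * mpow \<xi> \<beta>))"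
    unfolding peval_eq_sum[OF supp_le_pdiff[OF assms(1)]] by (rule norm_sum)
  also have "\<dots> \<le> (\<Sum>\<beta> | mdeg \<beta> \<le> m. (\<Prod>i\<in>UNIV. fact (\<alpha> i + \<beta> i) / fact (\<beta> i)) * Z)"
  proof (rule sum_mono)
    fix \<beta> :: "'a mindex"
    have "cmod (pdiff \<alpha> p \<beta> * mpow \<xi> \<beta>) =
        (\<Prod>i\<in>UNIV. fact (\<alpha> i + \<beta> i) / fact (\<beta> i)) * (cmod (p (\<lambda>i. \<alpha> i + \<beta> i)) * cmod (mpow \<xi> \<beta>))"
      by (simp add: pdiff_def norm_mult norm_divide prod_norm[symmetric] norm_fact)
    also have "\<dots> \<le> (\<Prod>i\<in>UNIV. fact (\<alpha> i + \<beta> i) / fact (\<beta> i)) *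
        (cmod (p (\<lambda>i. \<alpha> i + \<beta> i)) * norm \<xi> ^ mdeg \<beta>)"
      by (intro mult_left_mono norm_mpow_le prod_nonneg) auto
    also have "\<dots> \<le> (\<Prod>i\<in>UNIV. fact (\<alpha> i + \<beta> i) / fact (\<beta> i)) * Z"
      by (intro mult_left_mono Z' prod_nonneg) auto
    finally show "cmod (pdiff \<alpha> p \<beta> * mpow \<xi> \<beta>) \<le> (\<Prod>i\<in>UNIV. fact (\<alpha> i + \<beta> i) / fact (\<beta> i)) * Z" .
  qed
  also have "\<dots> = pdiff_weight m \<alpha> * Z"
    by (simp add: pdiff_weight_def sum_distrib_right)
  finally show ?thesis .
qed

text \<open>The base \<open>norm \<xi> + 1 \<ge> 1\<close> makes powers increase with the exponent,
  so monomials of all degrees up to \<open>N\<close> share one bound, also near the origin.\<close>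

lemma norm_peval_pdiff_le_power:
  assumes "supp_le m p" and M: "\<And>\<gamma>. cmod (p \<gamma>) \<le> M"
    and N: "\<And>\<beta>. p (\<lambda>i. \<alpha> i + \<beta> i) \<noteq> 0 \<Longrightarrow> mdeg \<beta> \<le> N"
  shows "cmod (peval (pdiff \<alpha> p) \<xi>) \<le> pdiff_weight m \<alpha> * (M * (norm \<xi> + 1) ^ N)"
proof (rule norm_peval_pdiff_le[OF assms(1)])
  have M0: "0 \<le> M" using order_trans[OF norm_ge_zero M] .
  then show "0 \<le> M * (norm \<xi> + 1) ^ N" by simp
  fix \<beta>
  show "cmod (p (\<lambda>i. \<alpha> i + \<beta> i)) * norm \<xi> ^ mdeg \<beta> \<le> M * (norm \<xi> + 1) ^ N"
  proof (cases "p (\<lambda>i. \<alpha> i + \<beta> i) = 0")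
    case False
    have "norm \<xi> ^ mdeg \<beta> \<le> (norm \<xi> + 1) ^ mdeg \<beta>" by (intro power_mono) auto
    also have "\<dots> \<le> (norm \<xi> + 1) ^ N" by (intro power_increasing N False) auto
    finally show ?thesis by (intro mult_mono M M0) auto
  qed (use M0 in simp)
qed

text \<open>A derivative of order \<open>|\<alpha>|\<close> takes \<open>|\<alpha>|\<close> from the
  available degree \<open>m - 1\<close>, and its weight \<open>t ^ mdeg \<alpha>\<close> puts
  exactly as much back; hence a single power of \<open>norm \<xi> + t\<close>.\<close>

lemma ptilde_le_lower_order:
  fixes q :: "'n::finite mindex \<Rightarrow> complex"
  assumes "supp_le k q" "k < m" and M: "\<And>\<gamma>. cmod (q \<gamma>) \<le> M" and "1 \<le> t"
  shows "ptilde q \<xi> t \<le> (\<Sum>\<alpha>::'n mindex | mdeg \<alpha> \<le> k. pdiff_weight k \<alpha>) * M * (norm \<xi> + t) ^ (m - 1)"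
proof -
  have M0: "0 \<le> M" using order_trans[OF norm_ge_zero M] .
  have term_le: "cmod (peval (pdiff \<alpha> q) \<xi>) * t ^ mdeg \<alpha> \<le> pdiff_weight k \<alpha> * (M * (norm \<xi> + t) ^ (m - 1))"
    if "mdeg \<alpha> \<le> k" for \<alpha>
  proof -
    have "cmod (peval (pdiff \<alpha> q) \<xi>) \<le> pdiff_weight k \<alpha> * (M * (norm \<xi> + 1) ^ (m - 1 - mdeg \<alpha>))"
    proof (rule norm_peval_pdiff_le_power[OF assms(1) M])
      fix \<beta> assume "q (\<lambda>i. \<alpha> i + \<beta> i) \<noteq> 0"
      then have "mdeg \<alpha> + mdeg \<beta> \<le> k"
        using assms(1) by (metis mdeg_add not_less supp_le_def)
      then show "mdeg \<beta> \<le> m - 1 - mdeg \<alpha>" using \<open>k < m\<close> by linarith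
    qed
    then have "cmod (peval (pdiff \<alpha> q) \<xi>) * t ^ mdeg \<alpha> \<le>
        pdiff_weight k \<alpha> * (M * (norm \<xi> + 1) ^ (m - 1 - mdeg \<alpha>)) * t ^ mdeg \<alpha>"
      using \<open>1 \<le> t\<close> by (intro mult_right_mono) auto
    also have "\<dots> \<le> pdiff_weight k \<alpha> * (M * (norm \<xi> + t) ^ (m - 1 - mdeg \<alpha>)) * (norm \<xi> + t) ^ mdeg \<alpha>"
      using \<open>1 \<le> t\<close> M0
      by (intro mult_mono mult_nonneg_nonneg power_mono order_refl pdiff_weight_nonneg) auto
    also have "\<dots> = pdiff_weight k \<alpha> * (M * (norm \<xi> + t) ^ (m - 1))"
      using that \<open>k < m\<close> by (simp add: power_add[symmetric])
    finally show ?thesis .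
  qed
  have "(\<Sum>\<alpha> | mdeg \<alpha> \<le> k. cmod (peval (pdiff \<alpha> q) \<xi>) * t ^ mdeg \<alpha>) \<le>
      (\<Sum>\<alpha>::'n mindex | mdeg \<alpha> \<le> k. pdiff_weight k \<alpha> * (M * (norm \<xi> + t) ^ (m - 1)))"
    by (rule sum_mono, rule term_le) simp
  then show ?thesis
    using ptilde_le_sum[OF assms(1), of t \<xi>] \<open>1 \<le> t\<close>
    by (simp add: sum_distrib_right mult.assoc)
qed

text \<open>After one differentiation the top coefficients of \<open>pm - p\<close>, of size
  \<open>\<delta>\<close>, stand at degree \<open>m - 1\<close>. The others, of size
  \<open>M\<close>, stand at degree at most \<open>m - 2\<close>, which gains a factor
  \<open>1 / norm \<xi>\<close> outside the unit ball.\<close>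

lemma norm_pgrad_le:
  fixes p pm :: "'n::finite mindex \<Rightarrow> complex"
  assumes "supp_le m p" "supp_le m pm" "1 \<le> norm \<xi>" "0 \<le> M" "0 \<le> \<delta>"
    and M: "\<And>\<alpha>. mdeg \<alpha> < m \<Longrightarrow> cmod (pm \<alpha> - p \<alpha>) \<le> M"
    and \<delta>: "\<And>\<alpha>. mdeg \<alpha> = m \<Longrightarrow> cmod (pm \<alpha> - p \<alpha>) \<le> \<delta>"
  shows "norm (pgrad pm \<xi>) \<le> (\<Sum>i\<in>UNIV. cmod (peval (pdiff (munit i) p) \<xi>)) +
    (\<Sum>i\<in>UNIV. pdiff_weight m (munit i :: 'n mindex)) * ((\<delta> + M / norm \<xi>) * norm \<xi> ^ (m - 1))"
proof -
  let ?Z = "(\<delta> + M / norm \<xi>) * norm \<xi> ^ (m - 1)"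
  have d: "supp_le m (\<lambda>\<alpha>. pm \<alpha> - p \<alpha>)" using assms(1,2) by (intro supp_le_diff)
  have diff: "cmod (peval (pdiff (munit i) (\<lambda>\<alpha>. pm \<alpha> - p \<alpha>)) \<xi>) \<le> pdiff_weight m (munit i) * ?Z" for i
  proof (rule norm_peval_pdiff_le[OF d])
    show "0 \<le> ?Z" using assms by auto
    fix \<beta> :: "'n mindex"
    let ?\<alpha> = "\<lambda>j. munit i j + \<beta> j"
    assume le: "mdeg (munit i) + mdeg \<beta> \<le> m"
    have deg: "mdeg ?\<alpha> = Suc (mdeg \<beta>)" by (simp add: mdeg_add mdeg_munit)
    show "cmod (pm ?\<alpha> - p ?\<alpha>) * norm \<xi> ^ mdeg \<beta> \<le> ?Z"
    proof (cases "mdeg ?\<alpha> = m")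
      case True
      then have "mdeg \<beta> = m - 1" using deg by simp
      moreover have "cmod (pm ?\<alpha> - p ?\<alpha>) \<le> \<delta> + M / norm \<xi>"
        using \<delta>[OF True] assms(3,4) by (simp add: add_increasing2)
      ultimately show ?thesis by (simp add: mult_right_mono)
    next
      case False
      then have lt: "mdeg ?\<alpha> < m" using le deg by (simp add: mdeg_munit)
      \<comment> \<open>The multi-index has degree at least 1 and below \<open>m\<close>, so
        \<open>m \<ge> 2\<close> and the subtraction is not truncated.\<close>
      then have m: "m - 1 = Suc (m - 2)" "mdeg \<beta> \<le> m - 2" using deg by auto
      have "cmod (pm ?\<alpha> - p ?\<alpha>) * norm \<xi> ^ mdeg \<beta> \<le> M * norm \<xi> ^ (m - 2)"
        using assms m by (intro mult_mono M lt power_increasing) auto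
      also have "\<dots> = M / norm \<xi> * norm \<xi> ^ (m - 1)" using assms(3) unfolding m(1) by auto
      also have "\<dots> \<le> ?Z" using assms by (intro mult_right_mono) auto
      finally show ?thesis .
    qed
  qed
  have "norm (pgrad pm \<xi>) \<le> (\<Sum>i\<in>UNIV. cmod (peval (pdiff (munit i) pm) \<xi>))"
    using L2_set_le_sum[of UNIV "\<lambda>i. cmod (peval (pdiff (munit i) pm) \<xi>)"]
    by (simp add: norm_vec_def pgrad_def)
  also have "\<dots> \<le> (\<Sum>i\<in>UNIV. cmod (peval (pdiff (munit i) p) \<xi>) + pdiff_weight m (munit i) * ?Z)"
  proof (rule sum_mono)
    fix i :: 'n
    have "peval (pdiff (munit i) (\<lambda>\<alpha>. pm \<alpha> - p \<alpha>)) \<xi> =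
        peval (pdiff (munit i) pm) \<xi> - peval (pdiff (munit i) p) \<xi>"
      unfolding pdiff_diff by (intro peval_diff[of m] supp_le_pdiff assms)
    then show "cmod (peval (pdiff (munit i) pm) \<xi>) \<le>
        cmod (peval (pdiff (munit i) p) \<xi>) + pdiff_weight m (munit i) * ?Z"
      using diff[of i] norm_triangle_sub[of "peval (pdiff (munit i) pm) \<xi>" "peval (pdiff (munit i) p) \<xi>"]
      by simp
  qed
  finally show ?thesis by (simp add: sum.distrib sum_distrib_right)
qed

text \<open>Differentiating by a multi-index of full degree leaves only the constant
  \<open>\<alpha>! p \<alpha>\<close>, and \<open>\<alpha>! \<ge> 1\<close>.\<close>

lemma power_mdeg_le_ptilde:
  assumes "supp_le m p" "0 \<le> t" "mdeg \<alpha> = m"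
  shows "cmod (p \<alpha>) * t ^ m \<le> ptilde p \<xi> t"
proof -
  have "pdiff \<alpha> p \<beta> = 0" if "0 < mdeg \<beta>" for \<beta>
    using assms(1,3) that by (simp add: supp_le_def pdiff_def mdeg_add)
  then have "supp_le 0 (pdiff \<alpha> p)" by (simp add: supp_le_def)
  from peval_eq_sum[OF this] have "peval (pdiff \<alpha> p) \<xi> = (\<Prod>i\<in>UNIV. fact (\<alpha> i)) * p \<alpha>"
    by (simp add: mdeg_eq_0_iff mpow_def pdiff_def)
  then have "cmod (peval (pdiff \<alpha> p) \<xi>) = (\<Prod>i\<in>UNIV. fact (\<alpha> i)) * cmod (p \<alpha>)"
    by (simp add: norm_mult prod_norm[symmetric] norm_fact)
  moreover have "1 \<le> (\<Prod>i\<in>UNIV. fact (\<alpha> i) :: real)" by (intro prod_ge_1) auto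
  ultimately have "cmod (p \<alpha>) \<le> cmod (peval (pdiff \<alpha> p) \<xi>)"
    by (simp add: mult_le_cancel_right1)
  then have "cmod (p \<alpha>) * t ^ m \<le> cmod (peval (pdiff \<alpha> p) \<xi>) * t ^ mdeg \<alpha>"
    using assms by (simp add: mult_right_mono)
  also have "\<dots> \<le> ptilde p \<xi> t" by (rule peval_pdiff_le_ptilde[OF assms(1)])
  finally show ?thesis .
qed

lemma power_add_le:
  fixes x y :: real
  assumes "0 \<le> x" "0 \<le> y"
  shows "(x + y) ^ n \<le> 2 ^ n * (x ^ n + y ^ n)"
proof -
  have "(x + y) ^ n \<le> (2 * max x y) ^ n" using assms by (intro power_mono) auto
  also have "\<dots> \<le> 2 ^ n * (x ^ n + y ^ n)"
    using assms by (auto simp: power_mult_distrib max_def)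
  finally show ?thesis .
qed

section \<open>The lower bound for a single polynomial\<close>

text \<open>\<open>G\<close> inverts the gradient bound of \<open>pm\<close>, and \<open>H\<close>
  inverts a top coefficient of \<open>p\<close>. Passing from the gradient of \<open>pm\<close> to
  that of \<open>p\<close> costs \<open>G * D * (\<delta> + M / norm \<xi>)\<close> times
  \<open>norm \<xi> ^ (m - 1)\<close>. Small \<open>\<delta>\<close> and large
  \<open>norm \<xi>\<close> make each summand at most a quarter, so the error is absorbed on the
  left. The two summands of the final constant serve large and small \<open>norm \<xi>\<close>
  respectively.\<close>

lemma ptilde_lower_bound:
  fixes p pm :: "'n::finite mindex \<Rightarrow> complex" and m :: nat
  defines "D \<equiv> \<Sum>i\<in>UNIV. pdiff_weight m (munit i :: 'n mindex)"
  assumes "0 < m" "supp_le m p" "supp_le m pm" "0 \<le> M" "0 \<le> \<delta>" "0 \<le> G" "0 \<le> H"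
    and M: "\<And>\<alpha>. mdeg \<alpha> < m \<Longrightarrow> cmod (pm \<alpha> - p \<alpha>) \<le> M"
    and \<delta>: "\<And>\<alpha>. mdeg \<alpha> = m \<Longrightarrow> cmod (pm \<alpha> - p \<alpha>) \<le> \<delta>"
    and grad: "norm \<xi> ^ (m - 1) \<le> G * norm (pgrad pm \<xi>)"
    and small: "4 * G * D * \<delta> \<le> 1"
    and H: "mdeg \<alpha> = m" "1 \<le> H * cmod (p \<alpha>)"
    and "1 \<le> t"
  shows "t * (norm \<xi> + t) ^ (m - 1) \<le>
    (2 ^ (m - 1) * (2 * G * real CARD('n) + H) + (2 + 4 * G * D * M) ^ (m - 1) * H) * ptilde p \<xi> t"
proof -
  let ?x = "norm \<xi>" and ?T = "ptilde p \<xi> t"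
  have D0: "0 \<le> D" unfolding D_def by (intro sum_nonneg pdiff_weight_nonneg)
  have T0: "0 \<le> ?T" by (rule ptilde_nonneg[OF assms(3)])
  have tm: "t * t ^ (m - 1) = t ^ m" using \<open>0 < m\<close> by (simp add: power_eq_if)
  have "1 * t ^ m \<le> (H * cmod (p \<alpha>)) * t ^ m" using H \<open>1 \<le> t\<close> by (intro mult_right_mono) auto
  also have "\<dots> \<le> H * ?T"
    using power_mdeg_le_ptilde[OF assms(3) _ H(1), of t \<xi>] \<open>1 \<le> t\<close> \<open>0 \<le> H\<close>
    by (simp add: mult.assoc mult_left_mono)
  finally have top: "t ^ m \<le> H * ?T" by simp
  let ?A = "2 ^ (m - 1) * (2 * G * real CARD('n) + H)" and ?B = "(2 + 4 * G * D * M) ^ (m - 1) * H"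
  have AB: "0 \<le> ?A" "0 \<le> ?B" using assms D0 by auto
  \<comment> \<open>Beyond this radius \<open>G * D * M / norm \<xi> \<le> 1 / 4\<close>; the
    summand 1 ensures \<open>norm \<xi> \<ge> 1\<close>, as the gradient comparison
    requires.\<close>
  show ?thesis
  proof (cases "1 + 4 * G * D * M \<le> ?x")
    case True
    have x1: "1 \<le> ?x" using True assms D0 by (smt (verit) mult_nonneg_nonneg)
    let ?S = "\<Sum>i\<in>UNIV. cmod (peval (pdiff (munit i) p) \<xi>)"
    have "?x ^ (m - 1) \<le> G * (?S + D * ((\<delta> + M / ?x) * ?x ^ (m - 1)))"
      using grad norm_pgrad_le[OF assms(3,4) x1 assms(5,6) M \<delta>] \<open>0 \<le> G\<close>
      unfolding D_def by (meson mult_left_mono order_trans)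
    also have "\<dots> = G * ?S + (G * D * \<delta> + G * D * M / ?x) * ?x ^ (m - 1)"
      by (simp add: algebra_simps)
    also have "\<dots> \<le> G * ?S + (1/2) * ?x ^ (m - 1)"
    proof -
      have "G * D * M / ?x \<le> 1 / 4" using True x1 by (simp add: divide_simps)
      then have "G * D * \<delta> + G * D * M / ?x \<le> 1 / 2" using small by linarith
      then show ?thesis using x1 by (intro add_left_mono mult_right_mono) auto
    qed
    finally have "?x ^ (m - 1) \<le> 2 * G * ?S" by simp
    then have "t * ?x ^ (m - 1) \<le> 2 * G * (?S * t)" using \<open>1 \<le> t\<close> by (simp add: mult_left_mono mult_ac)
    also have "\<dots> \<le> 2 * G * (real CARD('n) * ?T)"
    proof -
      have "?S * t \<le> (\<Sum>i\<in>(UNIV::'n set). ?T)"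
        unfolding sum_distrib_right
        by (rule sum_mono) (use peval_pdiff_le_ptilde[OF assms(3), of "munit _" \<xi> t] in \<open>simp add: mdeg_munit\<close>)
      then show ?thesis using \<open>0 \<le> G\<close> by (intro mult_left_mono) auto
    qed
    finally have low: "t * ?x ^ (m - 1) \<le> 2 * G * (real CARD('n) * ?T)" .
    have "t * (?x + t) ^ (m - 1) \<le> t * (2 ^ (m - 1) * (?x ^ (m - 1) + t ^ (m - 1)))"
      using \<open>1 \<le> t\<close> by (intro mult_left_mono power_add_le) auto
    also have "\<dots> = 2 ^ (m - 1) * (t * ?x ^ (m - 1) + t ^ m)"
      unfolding tm[symmetric] by (simp add: algebra_simps)
    also have "\<dots> \<le> 2 ^ (m - 1) * (2 * G * (real CARD('n) * ?T) + H * ?T)"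
      by (intro mult_left_mono add_mono low top) auto
    also have "\<dots> = ?A * ?T" by (simp add: algebra_simps)
    also have "\<dots> \<le> (?A + ?B) * ?T" using AB T0 by (intro mult_right_mono) auto
    finally show ?thesis .
  next
    case False
    \<comment> \<open>Inside the radius \<open>norm \<xi> + t\<close> is at most a constant multiple
      of \<open>t\<close>, because \<open>t \<ge> 1\<close>; then \<open>top\<close> alone
      suffices.\<close>
    have R0: "0 \<le> 1 + 4 * G * D * M" using assms D0 by auto
    have "?x + t \<le> (1 + 4 * G * D * M) * t + t"
      using False R0 \<open>1 \<le> t\<close> by (smt (verit) mult_left_mono mult_cancel_left1)
    then have "(?x + t) ^ (m - 1) \<le> ((2 + 4 * G * D * M) * t) ^ (m - 1)"
      using \<open>1 \<le> t\<close> by (intro power_mono) (auto simp: algebra_simps)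
    then have "t * (?x + t) ^ (m - 1) \<le> (2 + 4 * G * D * M) ^ (m - 1) * t ^ m"
      using \<open>1 \<le> t\<close> unfolding tm[symmetric] by (simp add: power_mult_distrib mult_left_mono mult_ac)
    also have "\<dots> \<le> (2 + 4 * G * D * M) ^ (m - 1) * (H * ?T)"
      using R0 by (intro mult_left_mono top) auto
    also have "\<dots> \<le> (?A + ?B) * ?T" using mult_right_mono[of ?B "?A + ?B" ?T] AB T0 by (simp add: mult.assoc)
    finally show ?thesis .
  qed
qed

section \<open>Nets and representatives\<close>

lemma moderate_norm: "moderate u \<Longrightarrow> moderate (\<lambda>\<epsilon>. norm (u \<epsilon>))"
  by (simp add: moderate_def)

lemma moderate_const: "moderate (\<lambda>_. c)"
  unfolding moderate_def by (rule exI[of _ 0]) simp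

lemma moderate_sum: "(\<And>a. a \<in> A \<Longrightarrow> moderate (u a)) \<Longrightarrow> moderate (\<lambda>\<epsilon>. \<Sum>a\<in>A. u a \<epsilon>)"
  by (induction A rule: infinite_finite_induct) (auto intro: moderate_0 moderate_add)

lemma moderate_power:
  fixes u :: "real \<Rightarrow> 'a::real_normed_algebra_1"
  shows "moderate u \<Longrightarrow> moderate (\<lambda>\<epsilon>. u \<epsilon> ^ n)"
  by (induction n) (auto intro: moderate_1 moderate_mult)

lemma negligible_norm: "negligible_net u \<Longrightarrow> negligible_net (\<lambda>\<epsilon>. norm (u \<epsilon>))"
  by (simp add: negligible_net_def)

lemma negligible_sum:
  "(\<And>a. a \<in> A \<Longrightarrow> negligible_net (u a)) \<Longrightarrow> negligible_net (\<lambda>\<epsilon>. \<Sum>a\<in>A. u a \<epsilon>)"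
  by (induction A rule: infinite_finite_induct) (auto intro: negligible_0 negligible_add)

lemma eventually_at_right_unit: "eventually (\<lambda>\<epsilon>::real. \<epsilon> \<in> {0<..<1}) (at_right 0)"
  by (rule eventually_at_right_real) simp

text \<open>On \<open>(0,1)\<close> a smaller exponent gives a larger power, so any natural
  \<open>N \<ge> - a\<close> is a witness, whatever the sign of \<open>a\<close>.\<close>

lemma moderate_powr: "moderate (\<lambda>\<epsilon>. \<epsilon> powr a)"
proof -
  obtain N :: nat where N: "- a \<le> real N" using real_arch_simple by blast
  have "(\<lambda>\<epsilon>. norm (\<epsilon> powr a)) \<in> O[at_right 0](\<lambda>\<epsilon>. 1 / \<epsilon> ^ N)"
  proof (rule bigoI[of _ 1])
    show "eventually (\<lambda>\<epsilon>. norm (norm (\<epsilon> powr a)) \<le> 1 * norm (1 / \<epsilon> ^ N)) (at_right 0)"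
      using eventually_at_right_unit
    proof eventually_elim
      case (elim \<epsilon>)
      then have "\<epsilon> powr a \<le> \<epsilon> powr (- real N)" using N by (intro powr_mono') auto
      then show ?case using elim by (simp add: powr_minus powr_realpow divide_inverse)
    qed
  qed
  then show ?thesis unfolding moderate_def by blast
qed

text \<open>Exponent 1 in the definition is enough: \<open>c * \<epsilon> \<le> e\<close> as soon as
  \<open>\<epsilon> < e / c\<close>.\<close>

lemma negligible_eventually_le:
  assumes "negligible_net u" "0 < e"
  shows "eventually (\<lambda>\<epsilon>. norm (u \<epsilon>) \<le> e) (at_right 0)"
proof -
  have "(\<lambda>\<epsilon>. norm (u \<epsilon>)) \<in> O[at_right 0](\<lambda>\<epsilon>. \<epsilon> ^ 1)"
    using assms(1) unfolding negligible_net_def by blast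
  then obtain c where "c > 0" and c: "eventually (\<lambda>\<epsilon>. norm (u \<epsilon>) \<le> c * \<bar>\<epsilon>\<bar>) (at_right 0)"
    by (auto elim!: landau_o.bigE)
  have "eventually (\<lambda>\<epsilon>::real. \<epsilon> \<in> {0<..<e / c}) (at_right 0)"
    by (rule eventually_at_right_real) (use \<open>c > 0\<close> \<open>0 < e\<close> in simp)
  with c show ?thesis
    by eventually_elim (use \<open>c > 0\<close> in \<open>auto simp: field_simps\<close>)
qed

section \<open>Representatives of classes in the ring of generalized numbers\<close>

lemma gc_rel_refl_iff: "gc_rel u u \<longleftrightarrow> moderate u"
  by (simp add: gc_rel_def negligible_0)

text \<open>The equivalence is partial: nets that are not moderate are related to nothing. Hence
  equality of classes is informative only together with moderateness on both sides.\<close>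

lemma gc_rel_iff: "gc_rel u v \<longleftrightarrow> moderate u \<and> moderate v \<and> abs_gcomplex u = abs_gcomplex v"
  using Quotient_rel[OF Quotient_gcomplex, of u v] by (auto simp: gc_rel_refl_iff)

lemma ex_represents: "\<exists>u. represents u c"
  using Quotient_abs_rep[OF Quotient_gcomplex, of c] Quotient_rep_reflp[OF Quotient_gcomplex, of c]
  by (auto simp: represents_def gc_rel_refl_iff)

lemma represents_diff: "represents u c \<Longrightarrow> represents v c \<Longrightarrow> negligible_net (\<lambda>\<epsilon>. u \<epsilon> - v \<epsilon>)"
  using gc_rel_iff[of u v] by (simp add: represents_def gc_rel_def)

text \<open>Nets that agree near zero differ by an eventually vanishing, hence negligible, net. This
  is what makes the later cutoff legitimate.\<close>

lemma represents_cong: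
  assumes "represents u c" and eq: "eventually (\<lambda>\<epsilon>. u \<epsilon> = v \<epsilon>) (at_right 0)"
  shows "represents v c"
proof -
  have "negligible_net (\<lambda>\<epsilon>. u \<epsilon> - v \<epsilon>)"
    unfolding negligible_net_def
  proof
    fix q :: nat
    show "(\<lambda>\<epsilon>. norm (u \<epsilon> - v \<epsilon>)) \<in> O[at_right 0](\<lambda>\<epsilon>. \<epsilon> ^ q)"
      by (rule bigoI[of _ 1]) (use eq in eventually_elim, simp)
  qed
  moreover from this have "moderate v"
    using moderate_diff[OF _ negligible_imp_moderate, of u "\<lambda>\<epsilon>. u \<epsilon> - v \<epsilon>"] assms(1)
    by (simp add: represents_def)
  ultimately show ?thesis using assms(1) gc_rel_iff[of u v] by (simp add: represents_def gc_rel_def)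
qed

text \<open>A representative \<open>v\<close> of the inverse satisfies \<open>u * v = 1\<close> up
  to a negligible net, so \<open>|u * v| \<ge> 1/2\<close> for small \<open>\<epsilon>\<close>; the
  witness is \<open>2 * v\<close>.\<close>

lemma represents_dvd_1:
  assumes "represents u c" "c dvd 1"
  obtains v :: "real \<Rightarrow> complex"
  where "moderate v" "eventually (\<lambda>\<epsilon>. 1 \<le> norm (v \<epsilon>) * norm (u \<epsilon>)) (at_right 0)"
proof -
  obtain d where d: "c * d = 1" using assms(2) by (metis dvdE)
  obtain v where v: "represents v d" using ex_represents by blast
  have "abs_gcomplex (\<lambda>\<epsilon>. u \<epsilon> * v \<epsilon>) = abs_gcomplex (\<lambda>_. 1)"
    using d v assms(1) times_gcomplex.abs_eq[of u v]
    by (simp add: represents_def gc_rel_refl_iff one_gcomplex_def)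
  then have "negligible_net (\<lambda>\<epsilon>. u \<epsilon> * v \<epsilon> - 1)"
    using v assms(1) gc_rel_iff[of "\<lambda>\<epsilon>. u \<epsilon> * v \<epsilon>" "\<lambda>_. 1"]
    by (simp add: represents_def gc_rel_def moderate_mult moderate_1)
  from negligible_eventually_le[OF this, of "1/2"]
  have "eventually (\<lambda>\<epsilon>. 1 \<le> norm (2 * v \<epsilon>) * norm (u \<epsilon>)) (at_right 0)"
  proof (rule eventually_mono)
    fix \<epsilon> assume "cmod (u \<epsilon> * v \<epsilon> - 1) \<le> 1 / 2"
    then have "1 / 2 \<le> cmod (u \<epsilon> * v \<epsilon>)"
      using norm_triangle_ineq2[of 1 "u \<epsilon> * v \<epsilon>"] by (simp add: norm_minus_commute)
    then show "1 \<le> norm (2 * v \<epsilon>) * norm (u \<epsilon>)" by (simp add: norm_mult mult.commute)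
  qed simp
  moreover have "moderate (\<lambda>\<epsilon>. 2 * v \<epsilon>)"
    using v by (intro moderate_mult moderate_const) (simp add: represents_def)
  ultimately show thesis using that by blast
qed

section \<open>Representatives of whole symbols and bounds for their coefficients\<close>

lemma ex_symbol_rep: "\<exists>p. symbol_rep m P p"
proof -
  obtain r where r: "\<And>c. represents (r c) c" using ex_represents by metis
  then have "symbol_rep m P (\<lambda>\<epsilon> \<alpha>. if mdeg \<alpha> \<le> m then r (P \<alpha>) \<epsilon> else 0)"
    by (simp add: symbol_rep_def poly_rep_def)
  then show ?thesis by blast
qed

lemma symbol_rep_supp_le: "symbol_rep m P p \<Longrightarrow> \<epsilon> \<in> {0<..1} \<Longrightarrow> supp_le m (p \<epsilon>)"
  by (simp add: symbol_rep_def poly_rep_def supp_le_def)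

lemma symbol_rep_moderate:
  assumes "symbol_rep m P p"
  shows "moderate (\<lambda>\<epsilon>. \<Sum>\<alpha> | mdeg \<alpha> \<le> m. cmod (p \<epsilon> \<alpha>))"
  using assms by (intro moderate_sum moderate_norm) (auto simp: symbol_rep_def poly_rep_def represents_def)

lemma norm_coeff_le_sum:
  assumes "supp_le m p"
  shows "cmod (p \<gamma>) \<le> (\<Sum>\<alpha> | mdeg \<alpha> \<le> m. cmod (p \<alpha>))"
proof (cases "mdeg \<gamma> \<le> m")
  case True
  then show ?thesis by (intro member_le_sum finite_mdeg_le) auto
qed (use assms in \<open>auto simp: supp_le_def intro: sum_nonneg\<close>)

section \<open>Operators of principal type\<close>

text \<open>For \<open>m = 0\<close> the exponent in the definition is \<open>-1\<close>, and a vanishing gradient violates the bound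
  at any \<open>\<xi> \<noteq> 0\<close>.\<close>

lemma principal_type_order_pos:
  fixes P :: "'n::finite mindex \<Rightarrow> gcomplex"
  assumes "principal_type m P"
  shows "0 < m"
proof (rule ccontr)
  assume "\<not> 0 < m"
  with assms obtain p a c where p: "principal_rep 0 P p" and "c > 0"
    and grad: "\<forall>\<epsilon>\<in>{0<..1}. \<forall>\<xi>. norm (pgrad (p \<epsilon>) \<xi>) \<ge> c * \<epsilon> powr a * norm \<xi> powi (- 1)"
    unfolding principal_type_def by auto
  have "supp_le 0 (p 1)" using p by (simp add: principal_rep_def poly_rep_def supp_le_def)
  then have "pgrad (p 1) \<xi> = 0" for \<xi>
    by (simp add: pgrad_def pdiff_eq_0[of 0] mdeg_munit vec_eq_iff)
  with grad[rule_format, of 1 "axis undefined 1"] \<open>c > 0\<close> show False by simp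
qed

text \<open>The top part of the arbitrary representative \<open>p\<close> need not be the
  \<open>pm\<close> supplied by the principal type condition, but the two differ negligibly, so the
  pointwise bound applies for small \<open>\<epsilon>\<close>. Arbitrary \<open>p\<close> matters
  when the representative is already tied to a hypothesis on principal symbols.\<close>

lemma principal_type_lower_bound:
  fixes P :: "'n::finite mindex \<Rightarrow> gcomplex"
  assumes "principal_type m P" "\<exists>\<alpha>. mdeg \<alpha> = m \<and> P \<alpha> dvd 1" "symbol_rep m P p"
  obtains K where "moderate K"
    "eventually (\<lambda>\<epsilon>. 0 \<le> K \<epsilon> \<and> (\<forall>\<xi> t. 1 \<le> t \<longrightarrow>
       t * (norm \<xi> + t) ^ (m - 1) \<le> K \<epsilon> * ptilde (p \<epsilon>) \<xi> t)) (at_right (0::real))"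
proof -
  note m = principal_type_order_pos[OF assms(1)]
  obtain pm a c where pm: "principal_rep m P pm" and "c > 0"
    and grad: "\<And>\<epsilon> \<xi>. \<epsilon> \<in> {0<..1} \<Longrightarrow> norm (pgrad (pm \<epsilon>) \<xi>) \<ge> c * \<epsilon> powr a * norm \<xi> powi (int m - 1)"
    using assms(1) unfolding principal_type_def by blast
  obtain \<alpha> where \<alpha>: "mdeg \<alpha> = m" "P \<alpha> dvd 1" using assms(2) by blast
  have "represents (\<lambda>\<epsilon>. p \<epsilon> \<alpha>) (P \<alpha>)"
    using assms(3) \<alpha> by (simp add: symbol_rep_def poly_rep_def)
  from represents_dvd_1[OF this \<alpha>(2)] obtain v where v: "moderate v"
    "eventually (\<lambda>\<epsilon>. 1 \<le> cmod (v \<epsilon>) * cmod (p \<epsilon> \<alpha>)) (at_right 0)" .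
  define D where "D = (\<Sum>i\<in>UNIV. pdiff_weight m (munit i :: 'n mindex))"
  \<comment> \<open>The reciprocal of the factor \<open>c * \<epsilon> powr a\<close> in the
    gradient bound.\<close>
  define G where "G = (\<lambda>\<epsilon>::real. \<epsilon> powr (- a) * inverse c)"
  define M where "M = (\<lambda>\<epsilon>. \<Sum>\<alpha> | mdeg \<alpha> \<le> m. cmod (p \<epsilon> \<alpha>))"
  define \<delta> where "\<delta> = (\<lambda>\<epsilon>. \<Sum>\<alpha> | mdeg \<alpha> = m. cmod (pm \<epsilon> \<alpha> - p \<epsilon> \<alpha>))"
  \<comment> \<open>The constant of \<open>ptilde_lower_bound\<close> with \<open>H = |v|\<close>,
    built from moderate nets by sums, products and powers only.\<close>
  define K where "K = (\<lambda>\<epsilon>. 2 ^ (m - 1) * (2 * G \<epsilon> * real CARD('n) + cmod (v \<epsilon>)) +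
      (2 + 4 * G \<epsilon> * D * M \<epsilon>) ^ (m - 1) * cmod (v \<epsilon>))"
  have modG: "moderate G" unfolding G_def by (intro moderate_mult moderate_powr moderate_const)
  have modM: "moderate M" unfolding M_def by (rule symbol_rep_moderate[OF assms(3)])
  have modK: "moderate K" unfolding K_def
    by (intro moderate_add moderate_mult moderate_power moderate_const moderate_norm modG modM v(1))
  have "negligible_net \<delta>" unfolding \<delta>_def
    using assms(3) pm
    by (intro negligible_sum negligible_norm represents_diff)
       (auto simp: symbol_rep_def principal_rep_def poly_rep_def)
  \<comment> \<open>Negligible times moderate is negligible, so the smallness condition on
    \<open>\<delta>\<close> holds for small \<open>\<epsilon>\<close>.\<close>
  then have "negligible_net (\<lambda>\<epsilon>. \<delta> \<epsilon> * (4 * G \<epsilon> * D))"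
    by (intro negligible_mult_moderate moderate_mult modG moderate_const)
  from negligible_eventually_le[OF this, of 1]
  have "eventually (\<lambda>\<epsilon>. norm (\<delta> \<epsilon> * (4 * G \<epsilon> * D)) \<le> 1) (at_right 0)" by simp
  with v(2) eventually_at_right_unit
  have "eventually (\<lambda>\<epsilon>. 0 \<le> K \<epsilon> \<and> (\<forall>\<xi> t. 1 \<le> t \<longrightarrow>
       t * (norm \<xi> + t) ^ (m - 1) \<le> K \<epsilon> * ptilde (p \<epsilon>) \<xi> t)) (at_right 0)"
  proof eventually_elim
    case (elim \<epsilon>)
    have \<epsilon>: "\<epsilon> \<in> {0<..1}" using elim by auto
    have nonneg: "0 \<le> G \<epsilon>" "0 \<le> M \<epsilon>" "0 \<le> \<delta> \<epsilon>" "0 \<le> D"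
      using \<open>c > 0\<close> by (auto simp: G_def M_def \<delta>_def D_def intro!: sum_nonneg pdiff_weight_nonneg)
    have supp: "supp_le m (p \<epsilon>)" by (rule symbol_rep_supp_le[OF assms(3) \<epsilon>])
    have pm0: "pm \<epsilon> \<beta> = 0" if "mdeg \<beta> \<noteq> m" for \<beta>
      using pm \<epsilon> that by (simp add: principal_rep_def poly_rep_def)
    have suppm: "supp_le m (pm \<epsilon>)" using pm0 by (simp add: supp_le_def)
    have "t * (norm \<xi> + t) ^ (m - 1) \<le> K \<epsilon> * ptilde (p \<epsilon>) \<xi> t" if "1 \<le> t" for \<xi> t
      unfolding K_def D_def
    proof (rule ptilde_lower_bound[OF m supp suppm nonneg(2,3,1) _ _ _ _ _ \<alpha>(1) _ that])
      show "cmod (pm \<epsilon> \<beta> - p \<epsilon> \<beta>) \<le> M \<epsilon>" if "mdeg \<beta> < m" for \<beta>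
        using norm_coeff_le_sum[OF supp, of \<beta>] that by (simp add: M_def pm0)
      show "cmod (pm \<epsilon> \<beta> - p \<epsilon> \<beta>) \<le> \<delta> \<epsilon>" if "mdeg \<beta> = m" for \<beta>
        unfolding \<delta>_def using that
        by (intro member_le_sum[of _ _ "\<lambda>\<beta>. cmod (pm \<epsilon> \<beta> - p \<epsilon> \<beta>)"]
              finite_subset[OF _ finite_mdeg_le[of m]]) auto
      \<comment> \<open>Since \<open>m > 0\<close>, the integer exponent is the natural number
        \<open>m - 1\<close>.\<close>
      have "norm \<xi> powi (int m - 1) = norm \<xi> ^ (m - 1)"
        using m by (simp add: power_int_def nat_diff_distrib)
      then show "norm \<xi> ^ (m - 1) \<le> G \<epsilon> * norm (pgrad (pm \<epsilon>) \<xi>)"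
        using grad[OF \<epsilon>, of \<xi>] \<epsilon> \<open>c > 0\<close> by (simp add: G_def powr_minus field_simps)
      show "4 * G \<epsilon> * (\<Sum>i\<in>UNIV. pdiff_weight m (munit i :: 'n mindex)) * \<delta> \<epsilon> \<le> 1"
        using elim(3) by (simp add: D_def mult_ac)
      show "1 \<le> cmod (v \<epsilon>) * cmod (p \<epsilon> \<alpha>)" by (rule elim(1))
    qed simp
    moreover have "0 \<le> K \<epsilon>" using nonneg by (simp add: K_def)
    ultimately show ?case by blast
  qed
  with modK show thesis by (rule that)
qed

text \<open>Representatives are only constrained as \<open>\<epsilon> \<rightarrow> 0\<close>. Making \<open>Q\<^sub>\<epsilon>\<close> vanish for \<open>\<epsilon> \<ge> \<eta>\<close> turns
  estimates valid for small \<open>\<epsilon>\<close> into estimates on all of \<open>(0,1]\<close>.\<close>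

lemma symbol_rep_cutoff:
  assumes "symbol_rep k Q q" "0 < \<eta>"
  shows "symbol_rep k Q (\<lambda>\<epsilon>. if \<epsilon> < \<eta> then q \<epsilon> else (\<lambda>_. 0))"
proof -
  have "eventually (\<lambda>\<epsilon>::real. \<epsilon> \<in> {0<..<\<eta>}) (at_right 0)"
    by (rule eventually_at_right_real) (rule assms(2))
  then have "eventually (\<lambda>\<epsilon>. q \<epsilon> \<alpha> = (if \<epsilon> < \<eta> then q \<epsilon> else (\<lambda>_. 0)) \<alpha>) (at_right 0)" for \<alpha>
    by eventually_elim simp
  with assms(1) show ?thesis
    unfolding symbol_rep_def poly_rep_def by (auto intro: represents_cong)
qed

text \<open>The factor \<open>t\<close> on the left becomes \<open>C t = 1 / t\<close>. For
  \<open>\<epsilon> \<ge> \<eta>\<close> the cutoff makes the left side zero; \<open>L\<close> may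
  be negative there, so \<open>norm (L \<epsilon>)\<close> keeps the right side nonnegative.\<close>

lemma dominatesI_eventually:
  assumes p: "symbol_rep m P p" and q: "symbol_rep k Q q" and "moderate L"
    and ev: "eventually (\<lambda>\<epsilon>. \<forall>\<xi> t. 1 \<le> t \<longrightarrow> t * ptilde (q \<epsilon>) \<xi> t \<le> L \<epsilon> * ptilde (p \<epsilon>) \<xi> t) (at_right 0)"
  shows "dominates m P k Q"
proof -
  obtain \<eta> where "0 < \<eta>" and \<eta>: "\<And>\<epsilon> \<xi> t. 0 < \<epsilon> \<Longrightarrow> \<epsilon> < \<eta> \<Longrightarrow> 1 \<le> t \<Longrightarrow>
      t * ptilde (q \<epsilon>) \<xi> t \<le> L \<epsilon> * ptilde (p \<epsilon>) \<xi> t"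
    using ev unfolding eventually_at_right_field by blast
  let ?q = "\<lambda>\<epsilon>. if \<epsilon> < \<eta> then q \<epsilon> else (\<lambda>_. 0)"
  have "ptilde (?q \<epsilon>) \<xi> t \<le> norm (L \<epsilon>) * (1 / t) * ptilde (p \<epsilon>) \<xi> t"
    if "\<epsilon> \<in> {0<..1}" "1 \<le> t" for \<epsilon> \<xi> t
  proof (cases "\<epsilon> < \<eta>")
    case True
    have T: "0 \<le> ptilde (p \<epsilon>) \<xi> t" by (rule ptilde_nonneg[OF symbol_rep_supp_le[OF p that(1)]])
    have "t * ptilde (q \<epsilon>) \<xi> t \<le> L \<epsilon> * ptilde (p \<epsilon>) \<xi> t" using \<eta> True that by auto
    also have "\<dots> \<le> norm (L \<epsilon>) * ptilde (p \<epsilon>) \<xi> t" using T by (intro mult_right_mono) auto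
    finally show ?thesis using True that by (simp add: field_simps)
  next
    case False
    then show ?thesis using that ptilde_nonneg[OF symbol_rep_supp_le[OF p that(1)]] by simp
  qed
  \<comment> \<open>The exponent \<open>b = - a\<close> works because
    \<open>t \<ge> \<epsilon> powr (- a)\<close> inverts to
    \<open>1 / t \<le> \<epsilon> powr a\<close>.\<close>
  moreover have "\<exists>b. \<forall>\<epsilon>\<in>{0<..1}. \<forall>t\<ge>1. t \<ge> \<epsilon> powr b \<longrightarrow> 1 / t \<le> \<epsilon> powr a" for a :: real
  proof (intro exI[of _ "- a"] ballI allI impI)
    fix \<epsilon> t :: real
    assume "\<epsilon> \<in> {0<..1}" "1 \<le> t" "\<epsilon> powr - a \<le> t"
    then show "1 / t \<le> \<epsilon> powr a"
      using le_imp_inverse_le[of "\<epsilon> powr - a" t] by (simp add: powr_minus divide_inverse)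
  qed
  moreover have "((\<lambda>t::real. 1 / t) \<longlongrightarrow> 0) at_top"
    using tendsto_inverse_0_at_top[OF filterlim_ident] by (simp add: divide_inverse)
  ultimately show ?thesis
    unfolding dominates_def
    by (intro exI[of _ p] exI[of _ ?q] exI[of _ "\<lambda>\<epsilon>. norm (L \<epsilon>)"] exI[of _ "\<lambda>t. 1 / t"] conjI
          p symbol_rep_cutoff[OF q \<open>0 < \<eta>\<close>] moderate_norm[OF \<open>moderate L\<close>]) auto
qed

lemma strongerI_eventually:
  assumes p: "symbol_rep m P p" and q: "symbol_rep k Q q" and "moderate L"
    and ev: "eventually (\<lambda>\<epsilon>. \<forall>\<xi>. ptilde (q \<epsilon>) \<xi> 1 \<le> L \<epsilon> * ptilde (p \<epsilon>) \<xi> 1) (at_right 0)"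
  shows "stronger m P k Q"
proof -
  obtain \<eta> where "0 < \<eta>" and \<eta>: "\<And>\<epsilon> \<xi>. 0 < \<epsilon> \<Longrightarrow> \<epsilon> < \<eta> \<Longrightarrow>
      ptilde (q \<epsilon>) \<xi> 1 \<le> L \<epsilon> * ptilde (p \<epsilon>) \<xi> 1"
    using ev unfolding eventually_at_right_field by blast
  let ?q = "\<lambda>\<epsilon>. if \<epsilon> < \<eta> then q \<epsilon> else (\<lambda>_. 0)"
  have "ptilde (?q \<epsilon>) \<xi> 1 \<le> norm (L \<epsilon>) * ptilde (p \<epsilon>) \<xi> 1" if "\<epsilon> \<in> {0<..1}" for \<epsilon> \<xi>
  proof -
    have T: "0 \<le> ptilde (p \<epsilon>) \<xi> 1" by (rule ptilde_nonneg[OF symbol_rep_supp_le[OF p that]])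
    then have "L \<epsilon> * ptilde (p \<epsilon>) \<xi> 1 \<le> norm (L \<epsilon>) * ptilde (p \<epsilon>) \<xi> 1"
      by (intro mult_right_mono) auto
    with T show ?thesis using \<eta>[of \<epsilon> \<xi>] that by auto
  qed
  then show ?thesis
    unfolding stronger_def
    by (intro exI[of _ p] exI[of _ ?q] exI[of _ "\<lambda>\<epsilon>. norm (L \<epsilon>)"] conjI
          p symbol_rep_cutoff[OF q \<open>0 < \<eta>\<close>] moderate_norm[OF \<open>moderate L\<close>]) auto
qed

text \<open>The upper bound for \<open>Q\<close> and the lower bound for \<open>P\<close> involve
  the same power of \<open>norm \<xi> + t\<close>; the surplus factor \<open>t\<close> in the lower
  bound supplies the decay.\<close>

lemma principal_type_dominates_lower_order:
  assumes "principal_type m P" "\<exists>\<alpha>. mdeg \<alpha> = m \<and> P \<alpha> dvd 1" "k < m"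
  shows "dominates m P k Q"
proof -
  obtain p where p: "symbol_rep m P p" using ex_symbol_rep by blast
  obtain q where q: "symbol_rep k Q q" using ex_symbol_rep by blast
  obtain K where K: "moderate K"
    "eventually (\<lambda>\<epsilon>. 0 \<le> K \<epsilon> \<and> (\<forall>\<xi> t. 1 \<le> t \<longrightarrow>
       t * (norm \<xi> + t) ^ (m - 1) \<le> K \<epsilon> * ptilde (p \<epsilon>) \<xi> t)) (at_right 0)"
    using principal_type_lower_bound[OF assms(1,2) p] .
  define M where "M = (\<lambda>\<epsilon>. \<Sum>\<alpha> | mdeg \<alpha> \<le> k. cmod (q \<epsilon> \<alpha>))"
  define B where "B = (\<Sum>\<alpha>::'a mindex | mdeg \<alpha> \<le> k. pdiff_weight k \<alpha>)"
  have B0: "0 \<le> B" unfolding B_def by (intro sum_nonneg pdiff_weight_nonneg)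
  show ?thesis
  proof (rule dominatesI_eventually[OF p q])
    show "moderate (\<lambda>\<epsilon>. B * M \<epsilon> * K \<epsilon>)"
      unfolding M_def by (intro moderate_mult moderate_const K symbol_rep_moderate[OF q])
    show "eventually (\<lambda>\<epsilon>. \<forall>\<xi> t. 1 \<le> t \<longrightarrow>
        t * ptilde (q \<epsilon>) \<xi> t \<le> B * M \<epsilon> * K \<epsilon> * ptilde (p \<epsilon>) \<xi> t) (at_right 0)"
      using K(2) eventually_at_right_unit
    proof eventually_elim
      case (elim \<epsilon>)
      show ?case
      proof (intro allI impI)
        fix \<xi> :: "real ^ 'a" and t :: real
        assume t: "1 \<le> t"
        have supp: "supp_le k (q \<epsilon>)" using symbol_rep_supp_le[OF q, of \<epsilon>] elim by auto
        have BM: "0 \<le> B * M \<epsilon>" unfolding M_def by (intro mult_nonneg_nonneg B0 sum_nonneg) auto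
        have "ptilde (q \<epsilon>) \<xi> t \<le> B * M \<epsilon> * (norm \<xi> + t) ^ (m - 1)"
          unfolding B_def M_def by (rule ptilde_le_lower_order[OF supp assms(3) norm_coeff_le_sum[OF supp] t])
        then have "t * ptilde (q \<epsilon>) \<xi> t \<le> B * M \<epsilon> * (t * (norm \<xi> + t) ^ (m - 1))"
          using t by (simp add: mult_left_mono mult_ac)
        also have "\<dots> \<le> B * M \<epsilon> * (K \<epsilon> * ptilde (p \<epsilon>) \<xi> t)"
          using elim t by (intro mult_left_mono BM) auto
        finally show "t * ptilde (q \<epsilon>) \<xi> t \<le> B * M \<epsilon> * K \<epsilon> * ptilde (p \<epsilon>) \<xi> t"
          by (simp add: mult.assoc)
      qed
    qed
  qed
qed

text \<open>The undifferentiated term is split off, since it alone can have full degree; every other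
  term has lost at least one degree.\<close>

lemma ptilde_le_peval:
  fixes q :: "'n::finite mindex \<Rightarrow> complex"
  assumes "supp_le m q" and M: "\<And>\<gamma>. cmod (q \<gamma>) \<le> M"
  shows "ptilde q \<xi> 1 \<le> cmod (peval q \<xi>) +
    (\<Sum>\<alpha>::'n mindex | mdeg \<alpha> \<le> m. pdiff_weight m \<alpha>) * M * (norm \<xi> + 1) ^ (m - 1)"
proof -
  let ?S = "{\<alpha>::'n mindex. mdeg \<alpha> \<le> m}" and ?z = "\<lambda>_::'n. 0::nat"
  let ?X = "M * (norm \<xi> + 1) ^ (m - 1)"
  have X0: "0 \<le> ?X" using order_trans[OF norm_ge_zero M] by simp
  have z: "?z \<in> ?S" by (simp add: mdeg_def)
  have "ptilde q \<xi> 1 \<le> (\<Sum>\<alpha>\<in>?S. cmod (peval (pdiff \<alpha> q) \<xi>))"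
    using ptilde_le_sum[OF assms(1), of 1] by simp
  also have "\<dots> = cmod (peval q \<xi>) + (\<Sum>\<alpha>\<in>?S - {?z}. cmod (peval (pdiff \<alpha> q) \<xi>))"
    by (subst sum.remove[OF finite_mdeg_le z]) (simp add: pdiff_zero)
  also have "(\<Sum>\<alpha>\<in>?S - {?z}. cmod (peval (pdiff \<alpha> q) \<xi>)) \<le> (\<Sum>\<alpha>\<in>?S - {?z}. pdiff_weight m \<alpha> * ?X)"
  proof (intro sum_mono norm_peval_pdiff_le_power assms)
    fix \<alpha> \<beta> :: "'n mindex"
    assume "\<alpha> \<in> ?S - {?z}" "q (\<lambda>i. \<alpha> i + \<beta> i) \<noteq> 0"
    then have "mdeg \<alpha> \<noteq> 0" "mdeg \<alpha> + mdeg \<beta> \<le> m"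
      using assms(1) by (auto simp: mdeg_eq_0_iff supp_le_def mdeg_add not_less[symmetric])
    then show "mdeg \<beta> \<le> m - 1" by linarith
  qed
  also have "\<dots> \<le> (\<Sum>\<alpha>\<in>?S. pdiff_weight m \<alpha> * ?X)"
    by (intro sum_mono2 finite_mdeg_le mult_nonneg_nonneg[OF pdiff_weight_nonneg X0]) auto
  finally show ?thesis by (simp add: sum_distrib_right mult.assoc)
qed

text \<open>The top coefficients cancel, so only degrees below \<open>m\<close> remain; this is the
  derivative estimate at the zero multi-index.\<close>

lemma norm_peval_diff_principal_le:
  fixes p pm :: "'n::finite mindex \<Rightarrow> complex"
  assumes "supp_le m p" and M: "\<And>\<gamma>. cmod (p \<gamma>) \<le> M"
    and pm: "\<And>\<gamma>. pm \<gamma> = (if mdeg \<gamma> = m then p \<gamma> else 0)"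
  shows "cmod (peval p \<xi> - peval pm \<xi>) \<le> pdiff_weight m (\<lambda>_::'n. 0) * M * (norm \<xi> + 1) ^ (m - 1)"
proof -
  have suppm: "supp_le m pm" using pm by (simp add: supp_le_def)
  have "cmod (peval (pdiff (\<lambda>_. 0) (\<lambda>\<gamma>. p \<gamma> - pm \<gamma>)) \<xi>) \<le>
      pdiff_weight m (\<lambda>_::'n. 0) * (M * (norm \<xi> + 1) ^ (m - 1))"
  proof (rule norm_peval_pdiff_le_power[OF supp_le_diff[OF assms(1) suppm]])
    show "cmod (p \<gamma> - pm \<gamma>) \<le> M" for \<gamma>
      using M[of \<gamma>] order_trans[OF norm_ge_zero M] by (simp add: pm)
    show "mdeg \<beta> \<le> m - 1" if "p (\<lambda>i. 0 + \<beta> i) - pm (\<lambda>i. 0 + \<beta> i) \<noteq> 0" for \<beta>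
    proof (rule ccontr)
      assume "\<not> mdeg \<beta> \<le> m - 1"
      then show False using that assms(1) by (cases "mdeg \<beta> = m") (auto simp: pm supp_le_def)
    qed
  qed
  then show ?thesis by (simp add: pdiff_zero peval_diff[OF assms(1) suppm] mult.assoc)
qed

text \<open>A hypothesis on principal symbols fixes top coefficients only. Lower ones may come from
  any representative of the whole symbol, which makes \<open>pm\<close> the exact top part of
  \<open>p\<close>.\<close>

lemma ex_symbol_rep_extending:
  assumes "principal_rep m P pm"
  obtains p where "symbol_rep m P p"
    "\<And>\<epsilon> \<gamma>. \<epsilon> \<in> {0<..1} \<Longrightarrow> pm \<epsilon> \<gamma> = (if mdeg \<gamma> = m then p \<epsilon> \<gamma> else 0)"
proof -
  obtain p0 where p0: "symbol_rep m P p0" using ex_symbol_rep by blast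
  let ?p = "\<lambda>\<epsilon> \<gamma>. if mdeg \<gamma> = m then pm \<epsilon> \<gamma> else p0 \<epsilon> \<gamma>"
  have "symbol_rep m P ?p"
    unfolding symbol_rep_def poly_rep_def
  proof (intro conjI ballI allI impI)
    show "represents (\<lambda>\<epsilon>. ?p \<epsilon> \<gamma>) (P \<gamma>)" if "\<gamma> \<in> {\<alpha>. mdeg \<alpha> \<le> m}" for \<gamma>
      using assms p0 that
      by (cases "mdeg \<gamma> = m") (simp_all add: symbol_rep_def principal_rep_def poly_rep_def)
    show "?p \<epsilon> \<gamma> = 0" if "\<gamma> \<notin> {\<alpha>. mdeg \<alpha> \<le> m}" "\<epsilon> \<in> {0<..1}" for \<gamma> \<epsilon>
      using p0 that by (simp add: symbol_rep_def poly_rep_def)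
  qed
  moreover have "pm \<epsilon> \<gamma> = (if mdeg \<gamma> = m then ?p \<epsilon> \<gamma> else 0)" if "\<epsilon> \<in> {0<..1}" for \<epsilon> \<gamma>
    using assms that by (simp add: principal_rep_def poly_rep_def)
  ultimately show thesis by (rule that)
qed

text \<open>\<open>|Q|\<close> is compared with \<open>|Q_m|\<close>, by hypothesis with
  \<open>|P_m|\<close>, then with \<open>|P|\<close>, which is at most \<open>ptilde\<close>. Each
  change, and all derivatives of \<open>Q\<close>, cost a moderate multiple of
  \<open>(norm \<xi> + 1) ^ (m - 1)\<close>, which the lower bound at \<open>t = 1\<close> turns
  into \<open>ptilde\<close> of \<open>P\<close>.\<close>

lemma principal_type_stronger:
  fixes L :: "real \<Rightarrow> real"
  assumes "principal_type m P" "\<exists>\<alpha>. mdeg \<alpha> = m \<and> P \<alpha> dvd 1"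
    and L: "moderate L" and "principal_rep m Q qm" "principal_rep m P pm"
    and le: "\<And>\<epsilon> \<xi>. \<epsilon> \<in> {0<..1} \<Longrightarrow> cmod (peval (qm \<epsilon>) \<xi>) \<le> L \<epsilon> * cmod (peval (pm \<epsilon>) \<xi>)"
  shows "stronger m P m Q"
proof -
  obtain p where p: "symbol_rep m P p"
    and pm: "\<And>\<epsilon> \<gamma>. \<epsilon> \<in> {0<..1} \<Longrightarrow> pm \<epsilon> \<gamma> = (if mdeg \<gamma> = m then p \<epsilon> \<gamma> else 0)"
    using ex_symbol_rep_extending[OF assms(5)] by blast
  obtain q where q: "symbol_rep m Q q"
    and qm: "\<And>\<epsilon> \<gamma>. \<epsilon> \<in> {0<..1} \<Longrightarrow> qm \<epsilon> \<gamma> = (if mdeg \<gamma> = m then q \<epsilon> \<gamma> else 0)"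
    using ex_symbol_rep_extending[OF assms(4)] by blast
  obtain K where K: "moderate K"
    "eventually (\<lambda>\<epsilon>. 0 \<le> K \<epsilon> \<and> (\<forall>\<xi> t. 1 \<le> t \<longrightarrow>
       t * (norm \<xi> + t) ^ (m - 1) \<le> K \<epsilon> * ptilde (p \<epsilon>) \<xi> t)) (at_right 0)"
    using principal_type_lower_bound[OF assms(1,2) p] .
  define Mp where "Mp = (\<lambda>\<epsilon>. \<Sum>\<alpha> | mdeg \<alpha> \<le> m. cmod (p \<epsilon> \<alpha>))"
  define Mq where "Mq = (\<lambda>\<epsilon>. \<Sum>\<alpha> | mdeg \<alpha> \<le> m. cmod (q \<epsilon> \<alpha>))"
  define w where "w = pdiff_weight m (\<lambda>_::'a. 0)"
  define B where "B = (\<Sum>\<alpha>::'a mindex | mdeg \<alpha> \<le> m. pdiff_weight m \<alpha>)"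
  \<comment> \<open>Three errors: from \<open>P_m\<close> to \<open>P\<close>, amplified by
    \<open>L\<close>; from \<open>Q_m\<close> to \<open>Q\<close>; and from the derivatives of
    \<open>Q\<close>.\<close>
  define A where "A = (\<lambda>\<epsilon>. norm (L \<epsilon>) * (w * Mp \<epsilon>) + w * Mq \<epsilon> + B * Mq \<epsilon>)"
  have w0: "0 \<le> w" unfolding w_def by (rule pdiff_weight_nonneg)
  have B0: "0 \<le> B" unfolding B_def by (intro sum_nonneg pdiff_weight_nonneg)
  show ?thesis
  proof (rule strongerI_eventually[OF p q])
    show "moderate (\<lambda>\<epsilon>. norm (L \<epsilon>) + A \<epsilon> * K \<epsilon>)"
      unfolding A_def Mp_def Mq_def
      by (intro moderate_add moderate_mult moderate_const moderate_norm[OF L] K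
            symbol_rep_moderate[OF p] symbol_rep_moderate[OF q])
    show "eventually (\<lambda>\<epsilon>. \<forall>\<xi>. ptilde (q \<epsilon>) \<xi> 1 \<le>
        (norm (L \<epsilon>) + A \<epsilon> * K \<epsilon>) * ptilde (p \<epsilon>) \<xi> 1) (at_right 0)"
      using K(2) eventually_at_right_unit
    proof eventually_elim
      case (elim \<epsilon>)
      then have \<epsilon>: "\<epsilon> \<in> {0<..1}" by auto
      note sp = symbol_rep_supp_le[OF p \<epsilon>] and sq = symbol_rep_supp_le[OF q \<epsilon>]
      have A0: "0 \<le> A \<epsilon>"
        unfolding A_def Mp_def Mq_def
        by (intro add_nonneg_nonneg mult_nonneg_nonneg sum_nonneg w0 B0) auto
      show ?case
      proof
        fix \<xi> :: "real ^ 'a"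
        define X where "X = (norm \<xi> + 1) ^ (m - 1)"
        have X: "X \<le> K \<epsilon> * ptilde (p \<epsilon>) \<xi> 1"
          using elim(1) unfolding X_def by (metis mult_1 order_refl)
        have dp: "cmod (peval (p \<epsilon>) \<xi> - peval (pm \<epsilon>) \<xi>) \<le> w * Mp \<epsilon> * X"
          unfolding w_def Mp_def X_def
          by (rule norm_peval_diff_principal_le[OF sp norm_coeff_le_sum[OF sp] pm[OF \<epsilon>]])
        have dq: "cmod (peval (q \<epsilon>) \<xi> - peval (qm \<epsilon>) \<xi>) \<le> w * Mq \<epsilon> * X"
          unfolding w_def Mq_def X_def
          by (rule norm_peval_diff_principal_le[OF sq norm_coeff_le_sum[OF sq] qm[OF \<epsilon>]])
        have "cmod (peval (p \<epsilon>) \<xi>) \<le> ptilde (p \<epsilon>) \<xi> 1"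
          using peval_pdiff_le_ptilde[OF sp, of "\<lambda>_. 0" \<xi> 1] by (simp add: pdiff_zero)
        then have pm_le: "cmod (peval (pm \<epsilon>) \<xi>) \<le> ptilde (p \<epsilon>) \<xi> 1 + w * Mp \<epsilon> * X"
          using dp norm_triangle_ineq3[of "peval (p \<epsilon>) \<xi>" "peval (pm \<epsilon>) \<xi>"] by linarith
        have "cmod (peval (qm \<epsilon>) \<xi>) \<le> norm (L \<epsilon>) * cmod (peval (pm \<epsilon>) \<xi>)"
          using le[OF \<epsilon>, of \<xi>] by (rule order_trans) (intro mult_right_mono; simp)
        also have "\<dots> \<le> norm (L \<epsilon>) * (ptilde (p \<epsilon>) \<xi> 1 + w * Mp \<epsilon> * X)"
          by (intro mult_left_mono pm_le) simp
        finally have "cmod (peval (q \<epsilon>) \<xi>) \<le>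
            norm (L \<epsilon>) * (ptilde (p \<epsilon>) \<xi> 1 + w * Mp \<epsilon> * X) + w * Mq \<epsilon> * X"
          using dq norm_triangle_ineq2[of "peval (q \<epsilon>) \<xi>" "peval (qm \<epsilon>) \<xi>"] by linarith
        moreover have "ptilde (q \<epsilon>) \<xi> 1 \<le> cmod (peval (q \<epsilon>) \<xi>) + B * Mq \<epsilon> * X"
          unfolding B_def Mq_def X_def by (rule ptilde_le_peval[OF sq norm_coeff_le_sum[OF sq]])
        ultimately have "ptilde (q \<epsilon>) \<xi> 1 \<le> norm (L \<epsilon>) * ptilde (p \<epsilon>) \<xi> 1 + A \<epsilon> * X"
          unfolding A_def by (simp add: algebra_simps)
        also have "\<dots> \<le> norm (L \<epsilon>) * ptilde (p \<epsilon>) \<xi> 1 + A \<epsilon> * (K \<epsilon> * ptilde (p \<epsilon>) \<xi> 1)"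
          by (intro add_left_mono mult_left_mono X A0)
        finally show "ptilde (q \<epsilon>) \<xi> 1 \<le> (norm (L \<epsilon>) + A \<epsilon> * K \<epsilon>) * ptilde (p \<epsilon>) \<xi> 1"
          by (simp add: algebra_simps)
      qed
    qed
  qed
qed

theorem proposition1p13:
  fixes m :: nat and P :: "'n::finite mindex \<Rightarrow> gcomplex"
  assumes "diff_op m P"
    and "principal_type m P"
    and "\<exists>\<alpha>. mdeg \<alpha> = m \<and> P \<alpha> dvd 1"
  shows "(\<forall>k Q. k < m \<and> diff_op k Q \<longrightarrow> dominates m P k Q) \<and>
    (\<forall>Q. diff_op m Q \<and>
       (\<exists>(L :: real \<Rightarrow> real) q p. moderate L \<and> principal_rep m Q q \<and> principal_rep m P p \<and>
          (\<forall>\<epsilon>\<in>{0<..1}. \<forall>\<xi>. cmod (peval (q \<epsilon>) \<xi>) \<le> L \<epsilon> * cmod (peval (p \<epsilon>) \<xi>)))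
       \<longrightarrow> stronger m P m Q)"
  using principal_type_dominates_lower_order[OF assms(2,3)] principal_type_stronger[OF assms(2,3)]
  by blast

end
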